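(* Let $u>0$, $r>0$, and let $t$ be a time horizon ($t=\infty$ being allowed). Let $T$ be a non-negative random variable with density $f$ and distribution function $F$, let $L$ be a non-negative random variable independent of $T$, and let $(T_i,L_i)_{i\geqslant 1}$ be i.i.d. copies of $(T,L)$. Put $W_i(s):=1_{\{T_i\leqslant s\}}L_i-r\min\{T_i,s\}$ and \[q_n(t):=\mathbb{P}\left(\exists s\in[0,t]:\ \sum_{i=1}^n W_i(s)\geqslant nu\right).\] Assume the rarity condition \[\sup_{s\geqslant 0}\big(\mathbb{P}(T\leqslant s)\,\mathbb{E}L-r\,\mathbb{E}\min\{T,s\}\big)<u .\] Let $\omega_s(\alpha):=\mathbb{E}\,e^{\alpha W_1(s)}$, \[I(s):=\sup_{\alpha}\big(\alpha u-\log\omega_s(\alpha)\big),\qquad \alpha^\star(s):=\arg\sup_{\alpha}\big(\alpha u-\log\omega_s(\alpha)\big),\qquad t^\star:=\arg\inf_{s\in[0,t]}I(s).\] Assume that the function $\alpha^\star(\cdot)$ is bounded on $[0,t]$, i.e. $\sup_{s\in[0,t]}\alpha^\star(s)\leqslant M$ for some finite $M$. Then, as $n\to\infty$, \[\frac1n\log q_n(t)\to -I(t^\star).\]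
   Context: Interpretation: $n$ is the initial number of obligors, $nu$ the initial reserve, $T_i$ the time-to-default of obligor $i$, $L_i$ its loss at default, $r$ the income rate per non-defaulted obligor, and $W_i(s)$ the net cumulative loss of obligor $i$ at time $s$; $q_n(t)$ is the ruin probability up to time $t$. With $\bar\ell(\alpha):=\mathbb{E}\,e^{\alpha L}$, one has $\omega_s(\alpha)=\bar\ell(\alpha)\int_0^s f(v)e^{-r\alpha v}\,\mathrm{d}v+e^{-r\alpha s}(1-F(s))$. By definition of $t^\star$, $I(t^\star)=\inf_{s\in[0,t]}I(s)$. In the case $t=\infty$, the values at $s=\infty$ refer to $\omega_\infty(\alpha):=\lim_{s\to\infty}\omega_s(\alpha)=\bar\ell(\alpha)\,\mathbb{E}\,e^{-r\alpha T}$, and the boundedness assumption includes $\alpha^\star(\infty)<\infty$. *)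

theory Defs
  imports "HOL-Probability.Probability"
begin

text \<open>Logarithm with values in the extended reals: \<open>log 0 = -\<infinity>\<close>, \<open>log \<infinity> = \<infinity>\<close>.
  It is needed because exponential moments may be infinite and ruin probabilities may vanish.\<close>

definition ln_ext :: "ennreal \<Rightarrow> ereal" where
  "ln_ext x = (if x = 0 then -\<infinity> else if x = \<infinity> then \<infinity> else ereal (ln (enn2real x)))"

text \<open>Net loss at time \<open>s\<close> of an obligor with default time \<open>\<tau>\<close> and loss \<open>l\<close>.\<close>

definition net_loss :: "real \<Rightarrow> real \<Rightarrow> real \<Rightarrow> real \<Rightarrow> real" where
  "net_loss r \<tau> l s = indicator {..s} \<tau> * l - r * min \<tau> s"

text \<open>The horizon \<open>t\<close> may be \<open>\<infinity>\<close>; ruin happens at a finite time in any case.\<close>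

definition ruin_prob ::
  "'a measure \<Rightarrow> real \<Rightarrow> real \<Rightarrow> (nat \<Rightarrow> 'a \<Rightarrow> real) \<Rightarrow> (nat \<Rightarrow> 'a \<Rightarrow> real) \<Rightarrow> ereal \<Rightarrow> nat \<Rightarrow> real" where
  "ruin_prob M u r T L t n =
     measure M {x \<in> space M. \<exists>s::real. 0 \<le> s \<and> ereal s \<le> t \<and>
                  (\<Sum>i=1..n. net_loss r (T i x) (L i x) s) \<ge> real n * u}"

text \<open>\<open>\<omega>\<^sub>s(\<alpha>)\<close>, possibly infinite; at \<open>s = \<infinity>\<close> it is the limit of the values at finite times.\<close>

definition mgf :: "'a measure \<Rightarrow> real \<Rightarrow> ('a \<Rightarrow> real) \<Rightarrow> ('a \<Rightarrow> real) \<Rightarrow> real \<Rightarrow> real \<Rightarrow> ennreal" where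
  "mgf M r T L s \<alpha> = (\<integral>\<^sup>+ x. ennreal (exp (\<alpha> * net_loss r (T x) (L x) s)) \<partial>M)"

definition omega :: "'a measure \<Rightarrow> real \<Rightarrow> ('a \<Rightarrow> real) \<Rightarrow> ('a \<Rightarrow> real) \<Rightarrow> ereal \<Rightarrow> real \<Rightarrow> ennreal" where
  "omega M r T L s \<alpha> =
     (if s = \<infinity> then Lim at_top (\<lambda>v. mgf M r T L v \<alpha>) else mgf M r T L (real_of_ereal s) \<alpha>)"

definition rate_arg ::
  "'a measure \<Rightarrow> real \<Rightarrow> real \<Rightarrow> ('a \<Rightarrow> real) \<Rightarrow> ('a \<Rightarrow> real) \<Rightarrow> ereal \<Rightarrow> real \<Rightarrow> ereal" where
  "rate_arg M u r T L s \<alpha> = ereal (\<alpha> * u) - ln_ext (omega M r T L s \<alpha>)"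

definition rate ::
  "'a measure \<Rightarrow> real \<Rightarrow> real \<Rightarrow> ('a \<Rightarrow> real) \<Rightarrow> ('a \<Rightarrow> real) \<Rightarrow> ereal \<Rightarrow> ereal" where
  "rate M u r T L s = (SUP \<alpha>::real. rate_arg M u r T L s \<alpha>)"

text \<open>\<open>a s\<close> is the maximizer \<open>\<alpha>\<^sup>\<star>(s)\<close>, and these maximizers are bounded above on \<open>[0,t]\<close>.
  Times with \<open>\<P>(T \<le> s) = 0\<close> (always including \<open>s = 0\<close>, since \<open>T\<close> has a density) are exempt:
  there the net loss is almost surely \<open>-r s\<close>, so the objective is \<open>\<alpha> (u + r s)\<close>, which has no
  maximizer, and requiring one would make the condition unsatisfiable. No ruin occurs at these
  times, where the rate is \<open>\<infinity>\<close>.\<close>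

definition bounded_argsup ::
  "'a measure \<Rightarrow> real \<Rightarrow> real \<Rightarrow> ('a \<Rightarrow> real) \<Rightarrow> ('a \<Rightarrow> real) \<Rightarrow> ereal \<Rightarrow> (ereal \<Rightarrow> real) \<Rightarrow> bool" where
  "bounded_argsup M u r T L t a \<longleftrightarrow>
     (\<exists>B::real. \<forall>s\<in>{0..t}. measure M {x \<in> space M. ereal (T x) \<le> s} > 0 \<longrightarrow>
        is_arg_max (rate_arg M u r T L s) (\<lambda>_. True) (a s) \<and> a s \<le> B)"

end

theory Submission
  imports Defs "HOL-Real_Asymp.Real_Asymp"
begin

text \<open>
  The aggregate net loss \<open>\<Sum> W\<^sub>i(s)\<close> decreases in \<open>s\<close> except for its jumps at defaults. Ruin before \<open>t\<close>
  therefore shows at a default time, almost surely: some obligor \<open>j\<close> defaults at a time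
  \<open>T\<^sub>j \<le> t\<close> with \<open>\<Sum> W\<^sub>i(T\<^sub>j) \<ge> n u\<close>. This turns the supremum over a continuum of times into \<open>n\<close> events.

  Upper bound. Fix \<open>0 < c < I(t\<^sup>\<star>)\<close>. Condition on the default time \<open>T\<^sub>j = v\<close> and apply Markov's inequality
  with an exponent \<open>\<alpha> \<ge> 0\<close>, depending on \<open>v\<close>, such that \<open>\<omega>\<^sub>v(\<alpha>) \<le> e\<^bsup>\<alpha> u - c\<^esup>\<close>; it exists since
  \<open>I(v) > c\<close>, and it is not negative because rarity makes the mean of \<open>W(v)\<close> smaller than \<open>u\<close>.
  Obligor \<open>j\<close>, known to have defaulted at \<open>v\<close>, contributes \<open>E e\<^bsup>\<alpha>(L - r v)\<^esup>\<close> in place of \<open>\<omega>\<^sub>v(\<alpha>)\<close>,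
  but \<open>\<omega>\<^sub>v(\<alpha>) \<ge> F(v) E e\<^bsup>\<alpha>(L - r v)\<^esup>\<close>. The conditional probability is thus at most
  \<open>min 1 (e\<^bsup>-n c\<^esup> / F(v))\<close>. As \<open>F(T)\<close> is stochastically at least uniform, the expectation of this
  bound is \<open>e\<^bsup>-n c\<^esup>\<close> up to a factor linear in \<open>n\<close> (\<open>nn_integral_truncated_inverse_cdf\<close>,
  \<open>prob_ruin_at_default_le\<close>, \<open>ruin_prob_le\<close>).

  Lower bound. For a finite \<open>s \<le> t\<close> the ruin event contains \<open>{\<Sum> W\<^sub>i(s) \<ge> n u}\<close>, and for \<open>t = \<infinity>\<close> it
  contains \<open>{\<Sum> (L\<^sub>i - r T\<^sub>i) \<ge> n u}\<close>, since all \<open>n\<close> obligors have defaulted after a finite time.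
  Cramer's lower bound for i.i.d. sums (\<open>cramer_lower_bound\<close>) gives both cases. Positive exponential
  moments may be infinite, so its proof truncates the summands and minimises the truncated moment
  generating function; near the minimiser the exponentially weighted sum concentrates on \<open>0 \<le> S\<^sub>n \<le> \<delta> n\<close>,
  as the two complementary tails have weights that are exponentially smaller.
\<close>

section \<open>Truncated moment generating functions\<close>

text \<open>The truncation to a bounded set \<open>A\<close> keeps the function finite and smooth; the missing mass only
  lowers it, so lower bounds on probabilities survive.\<close>

definition trunc_mgf :: "real measure \<Rightarrow> real set \<Rightarrow> real \<Rightarrow> real" where
  "trunc_mgf N A \<alpha> = (\<integral>y. indicator A y * exp (\<alpha> * y) \<partial>N)"

lemma trunc_mgf_integrable:
  assumes "finite_measure N" "sets N = sets borel" "A \<in> sets borel" "bounded A"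
  shows "integrable N (\<lambda>y. indicator A y * exp (\<alpha> * y) :: real)"
proof -
  interpret finite_measure N by fact
  note [measurable_cong] = assms(2) and [measurable] = assms(3)
  obtain R where R: "\<And>y. y \<in> A \<Longrightarrow> \<bar>y\<bar> \<le> R"
    using assms(4) by (auto simp: bounded_iff)
  have "\<alpha> * y \<le> \<bar>\<alpha>\<bar> * R" if "y \<in> A" for y
  proof -
    have "\<alpha> * y \<le> \<bar>\<alpha>\<bar> * \<bar>y\<bar>" by (metis abs_ge_self abs_mult)
    also have "\<dots> \<le> \<bar>\<alpha>\<bar> * R" using R[OF that] by (simp add: mult_left_mono)
    finally show ?thesis .
  qed
  then have "norm (indicator A y * exp (\<alpha> * y) :: real) \<le> exp (\<bar>\<alpha>\<bar> * R)" for y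
    by (auto simp: indicator_def)
  then show ?thesis
    by (intro integrable_const_bound[where B="exp (\<bar>\<alpha>\<bar> * R)"]) auto
qed

lemma trunc_mgf_nonneg: "0 \<le> trunc_mgf N A \<alpha>"
  unfolding trunc_mgf_def by (intro integral_nonneg_AE) auto

lemma trunc_mgf_mono:
  assumes "finite_measure N" "sets N = sets borel" "A \<in> sets borel" "B \<in> sets borel"
    "bounded B" "A \<subseteq> B"
  shows "trunc_mgf N A \<alpha> \<le> trunc_mgf N B \<alpha>"
  unfolding trunc_mgf_def using assms
  by (intro integral_mono trunc_mgf_integrable bounded_subset[OF assms(5,6)])
     (auto simp: indicator_def)

text \<open>Convexity of the exponential passes to the integral, and a finite convex function on the line
  is continuous.\<close>

lemma continuous_on_trunc_mgf:
  assumes "finite_measure N" "sets N = sets borel" "A \<in> sets borel" "bounded A"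
  shows "continuous_on UNIV (trunc_mgf N A)"
proof -
  have "convex_on UNIV (trunc_mgf N A)"
  proof (rule convex_onI)
    fix t x y :: real assume t: "0 < t" "t < 1"
    have "trunc_mgf N A ((1 - t) * x + t * y)
        \<le> (\<integral>z. (1 - t) * (indicator A z * exp (x * z)) + t * (indicator A z * exp (y * z)) \<partial>N)"
      unfolding trunc_mgf_def
    proof (rule integral_mono)
      fix z
      have "exp ((1 - t) * (x * z) + t * (y * z)) \<le> (1 - t) * exp (x * z) + t * exp (y * z)"
        using convex_onD[OF exp_convex, of t "x * z" "y * z"] t by simp
      then show "indicator A z * exp (((1 - t) * x + t * y) * z)
          \<le> (1 - t) * (indicator A z * exp (x * z)) + t * (indicator A z * exp (y * z))"
        by (auto simp: indicator_def algebra_simps)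
    qed (intro Bochner_Integration.integrable_add integrable_mult_right trunc_mgf_integrable assms)+
    also have "\<dots> = (1 - t) * trunc_mgf N A x + t * trunc_mgf N A y"
      unfolding trunc_mgf_def
      by (subst Bochner_Integration.integral_add)
         (auto intro!: integrable_mult_right trunc_mgf_integrable assms)
    finally show "trunc_mgf N A ((1 - t) *\<^sub>R x + t *\<^sub>R y)
        \<le> (1 - t) * trunc_mgf N A x + t * trunc_mgf N A y" by simp
  qed simp
  then show ?thesis by (intro convex_on_continuous) auto
qed

lemma exp_add_exp_minus_le:
  fixes x :: real
  assumes "\<bar>x\<bar> \<le> 1"
  shows "exp x + exp (- x) \<le> 2 + 2 * x\<^sup>2"
proof -
  have *: "exp x + exp (- x) \<le> 2 + 2 * x\<^sup>2" if x: "0 \<le> x" "x \<le> 1" for x :: real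
  proof -
    have "1 \<le> 1 + x ^ 3" using x by simp
    also have "\<dots> = (1 + x) * (1 - x + x\<^sup>2)" by (simp add: power2_eq_square power3_eq_cube algebra_simps)
    also have "\<dots> \<le> exp x * (1 - x + x\<^sup>2)" using x
      by (intro mult_right_mono) (auto simp: exp_ge_add_one_self)
    finally have "exp (- x) \<le> 1 - x + x\<^sup>2" by (simp add: exp_minus field_simps)
    with exp_bound[OF x] show ?thesis by simp
  qed
  show ?thesis
  proof (cases "0 \<le> x")
    case True then show ?thesis using * assms by simp
  next
    case False then show ?thesis using *[of "- x"] assms by (simp add: add.commute)
  qed
qed

text \<open>For \<open>\<Phi>(\<alpha>) = e\<^bsup>-\<alpha> h\<^esup> trunc_mgf N A \<alpha>\<close> this reads
  \<open>\<Phi>(\<beta> + \<theta>) + \<Phi>(\<beta> - \<theta>) \<le> (2 + 2 (\<theta> R)\<^sup>2) \<Phi>(\<beta>)\<close>. At a minimiser \<open>\<beta>\<close> of \<open>\<Phi>\<close> each of the two terms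
  on the left is at least \<open>\<Phi>(\<beta>)\<close>, hence the other one exceeds \<open>\<Phi>(\<beta>)\<close> by a factor \<open>1 + O(\<theta>\<^sup>2)\<close> only.
  This replaces the vanishing of the derivative at the minimiser.\<close>

lemma trunc_mgf_second_difference:
  assumes "finite_measure N" "sets N = sets borel" "A \<in> sets borel" "bounded A"
    and R: "\<And>y. y \<in> A \<Longrightarrow> \<bar>y - h\<bar> \<le> R" and \<theta>: "0 \<le> \<theta>" "\<theta> * R \<le> 1"
  shows "exp (- (\<theta> * h)) * trunc_mgf N A (\<beta> + \<theta>) + exp (\<theta> * h) * trunc_mgf N A (\<beta> - \<theta>)
      \<le> (2 + 2 * (\<theta> * R)\<^sup>2) * trunc_mgf N A \<beta>"
proof -
  note I = trunc_mgf_integrable[OF assms(1-4)]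
  have "exp (- (\<theta> * h)) * trunc_mgf N A (\<beta> + \<theta>) + exp (\<theta> * h) * trunc_mgf N A (\<beta> - \<theta>)
      = (\<integral>y. exp (- (\<theta> * h)) * (indicator A y * exp ((\<beta> + \<theta>) * y))
            + exp (\<theta> * h) * (indicator A y * exp ((\<beta> - \<theta>) * y)) \<partial>N)"
    unfolding trunc_mgf_def
    by (subst Bochner_Integration.integral_add) (auto intro!: integrable_mult_right I)
  also have "\<dots> \<le> (\<integral>y. (2 + 2 * (\<theta> * R)\<^sup>2) * (indicator A y * exp (\<beta> * y)) \<partial>N)"
  proof (rule integral_mono)
    fix y
    show "exp (- (\<theta> * h)) * (indicator A y * exp ((\<beta> + \<theta>) * y))
            + exp (\<theta> * h) * (indicator A y * exp ((\<beta> - \<theta>) * y))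
        \<le> (2 + 2 * (\<theta> * R)\<^sup>2) * (indicator A y * exp (\<beta> * y))"
    proof (cases "y \<in> A")
      case True
      have a: "\<bar>\<theta> * (y - h)\<bar> \<le> \<theta> * R"
        using R[OF True] \<theta> by (simp add: abs_mult mult_left_mono)
      then have "\<bar>\<theta> * (y - h)\<bar> \<le> 1" using \<theta> by simp
      from exp_add_exp_minus_le[OF this]
      have "exp (\<theta> * (y - h)) + exp (- (\<theta> * (y - h))) \<le> 2 + 2 * (\<theta> * (y - h))\<^sup>2" .
      also have "(\<theta> * (y - h))\<^sup>2 \<le> (\<theta> * R)\<^sup>2" using a by (rule abs_le_square_iff[THEN iffD1, OF order_trans]) simp
      finally have "exp (\<beta> * y) * (exp (\<theta> * (y - h)) + exp (- (\<theta> * (y - h))))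
          \<le> exp (\<beta> * y) * (2 + 2 * (\<theta> * R)\<^sup>2)" by (simp add: mult_left_mono)
      then show ?thesis using True
        by (simp add: algebra_simps flip: exp_add)
    qed simp
  qed (intro Bochner_Integration.integrable_add integrable_mult_right I)+
  also have "\<dots> = (2 + 2 * (\<theta> * R)\<^sup>2) * trunc_mgf N A \<beta>"
    unfolding trunc_mgf_def by simp
  finally show ?thesis .
qed

lemma iid_prod_expectation:
  assumes "prob_space M" "prob_space.indep_vars M (\<lambda>_. borel) Y {1..}"
    and id: "\<And>i. i \<ge> 1 \<Longrightarrow> distr M borel (Y i) = N"
    and [measurable]: "g \<in> borel_measurable borel" and "integrable N g"
  shows "integrable M (\<lambda>x. \<Prod>i=1..n. g (Y i x))"
    and "(\<integral>x. (\<Prod>i=1..n. g (Y i x)) \<partial>M) = (\<integral>y. g y \<partial>N :: real) ^ n"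
proof -
  interpret prob_space M by fact
  have m: "random_variable borel (Y i)" if "i \<ge> 1" for i
    using assms(2) that by (auto simp: indep_vars_def)
  have ind: "indep_vars (\<lambda>_. borel) (\<lambda>i x. g (Y i x)) {1..n}"
    by (rule indep_vars_compose2[OF indep_vars_subset[OF assms(2)]]) auto
  have int: "integrable M (\<lambda>x. g (Y i x))" if "i \<in> {1..n}" for i
    using \<open>integrable N g\<close> that id[of i] m[of i] integrable_distr[of "Y i" M borel g] by auto
  have eq: "(\<integral>x. g (Y i x) \<partial>M) = (\<integral>y. g y \<partial>N)" if "i \<in> {1..n}" for i
    using that id[of i] m[of i] integral_distr[of "Y i" M borel g] by auto
  show "integrable M (\<lambda>x. \<Prod>i=1..n. g (Y i x))"
    by (rule indep_vars_integrable[OF _ ind int]) auto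
  have "(\<integral>x. (\<Prod>i=1..n. g (Y i x)) \<partial>M) = (\<Prod>i=1..n. \<integral>x. g (Y i x) \<partial>M)"
    by (rule indep_vars_lebesgue_integral[OF _ ind int]) auto
  then show "(\<integral>x. (\<Prod>i=1..n. g (Y i x)) \<partial>M) = (\<integral>y. g y \<partial>N) ^ n"
    using eq by simp
qed

lemma prod_indicator_exp:
  "(\<Prod>i\<in>I. indicator A (y i) * exp (\<alpha> * y i)) =
    (\<Prod>i\<in>I. indicator A (y i)) * exp (\<alpha> * (\<Sum>i\<in>I. y i) :: real)" if "finite I"
  using that by (simp add: prod.distrib exp_sum sum_distrib_left)

text \<open>Let \<open>S\<close> be the sum. Under the weight \<open>e\<^bsup>\<beta> S\<^esup>\<close> the event \<open>S < 0\<close> has mass at most that of the weight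
  \<open>e\<^bsup>(\<beta> - \<theta>) S\<^esup>\<close>, and the event \<open>S > \<delta> n\<close> at most \<open>e\<^bsup>-\<delta> \<theta> n\<^esup>\<close> times that of \<open>e\<^bsup>(\<beta> + \<theta>) S\<^esup>\<close>. The
  hypotheses \<open>low\<close> and \<open>up\<close> make both a fraction \<open>\<rho>\<^sup>n\<close> of the total mass. What is left sits on
  \<open>0 \<le> S \<le> \<delta> n\<close>, where the weight is at most \<open>e\<^bsup>\<beta> \<delta> n\<^esup>\<close>.\<close>

lemma prob_nonneg_sum_ge_trunc_mgf:
  assumes "prob_space M" "prob_space.indep_vars M (\<lambda>_. borel) Y {1..}"
    and id: "\<And>i. i \<ge> 1 \<Longrightarrow> distr M borel (Y i) = N"
    and A: "A \<in> sets borel" "bounded A"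
    and \<rho>: "0 \<le> \<theta>" "0 \<le> \<beta>" "0 \<le> \<rho>"
    and low: "trunc_mgf N A (\<beta> - \<theta>) \<le> \<rho> * trunc_mgf N A \<beta>"
    and up: "\<beta> > 0 \<Longrightarrow> exp (- (\<delta> * \<theta>)) * trunc_mgf N A (\<beta> + \<theta>) \<le> \<rho> * trunc_mgf N A \<beta>"
  shows "(exp (- (\<delta> * \<beta>)) * trunc_mgf N A \<beta>) ^ n * (1 - 2 * \<rho> ^ n)
    \<le> measure M {x \<in> space M. 0 \<le> (\<Sum>i=1..n. Y i x)}"
proof -
  interpret prob_space M by fact
  have m[measurable]: "random_variable borel (Y i)" if "i \<ge> 1" for i
    using assms(2) that by (auto simp: indep_vars_def)
  have N: "sets N = sets borel" "finite_measure N"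
    using id[of 1] m[of 1] by (auto intro!: prob_space.finite_measure prob_space_distr)
  note Z0 = trunc_mgf_nonneg[of N A]
  define E where "E = {x \<in> space M. 0 \<le> (\<Sum>i=1..n. Y i x)}"
  have E[measurable]: "E \<in> sets M" unfolding E_def by measurable
  define G where "G \<alpha> x = (\<Prod>i=1..n. indicator A (Y i x) * exp (\<alpha> * Y i x))" for \<alpha> :: real and x
  have g: "(\<lambda>y. indicator A y * exp (\<alpha> * y)) \<in> borel_measurable borel" for \<alpha> :: real
    using A by measurable
  have G: "integrable M (G \<alpha>)" "(\<integral>x. G \<alpha> x \<partial>M) = trunc_mgf N A \<alpha> ^ n" for \<alpha>
    unfolding G_def trunc_mgf_def
    using iid_prod_expectation[OF assms(1,2) id g trunc_mgf_integrable[OF N(2,1) A]] by auto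
  have Gx: "G \<alpha> x = (\<Prod>i=1..n. indicator A (Y i x)) * exp (\<alpha> * (\<Sum>i=1..n. Y i x))" for \<alpha> x
    unfolding G_def by (rule prod_indicator_exp) simp
  have P01: "0 \<le> (\<Prod>i=1..n. indicator A (Y i x) :: real)" "(\<Prod>i=1..n. indicator A (Y i x) :: real) \<le> 1" for x
    by (auto intro!: prod_nonneg prod_le_1)
  have G0: "0 \<le> G \<alpha> x" for \<alpha> x unfolding Gx using P01 by auto
  have lowG: "G \<beta> x \<le> G (\<beta> - \<theta>) x" if "(\<Sum>i=1..n. Y i x) < 0" for x
  proof -
    have "\<beta> * (\<Sum>i=1..n. Y i x) \<le> (\<beta> - \<theta>) * (\<Sum>i=1..n. Y i x)"
      using that \<rho> by (intro mult_right_mono_neg) auto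
    then show ?thesis unfolding Gx using P01 by (intro mult_left_mono) auto
  qed
  have iE: "integrable M (indicator E :: _ \<Rightarrow> real)"
    by (intro integrable_real_indicator E) (simp add: less_top[symmetric])
  define b where "b = exp (\<delta> * \<beta>) ^ n"
  have b: "b > 0" by (simp add: b_def)
  (* For \<beta> = 0 the weight is constant, so only the lower tail is removed. *)
  have main: "trunc_mgf N A \<beta> ^ n \<le> b * measure M E + 2 * (\<rho> * trunc_mgf N A \<beta>) ^ n"
  proof (cases "\<beta> = 0")
    case True
    have "trunc_mgf N A \<beta> ^ n \<le> (\<integral>x. indicator E x + G (\<beta> - \<theta>) x \<partial>M)"
      unfolding G(2)[symmetric]
    proof (rule integral_mono)
      fix x assume x: "x \<in> space M"
      show "G \<beta> x \<le> indicator E x + G (\<beta> - \<theta>) x"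
      proof (cases "x \<in> E")
        case True
        have "G \<beta> x \<le> 1" unfolding Gx \<open>\<beta> = 0\<close> using P01(2)[of x] by simp
        then show ?thesis using True G0[of "\<beta> - \<theta>" x] by (simp del: One_nat_def)
      next
        case False
        then have "G \<beta> x \<le> G (\<beta> - \<theta>) x" using x by (intro lowG) (simp add: E_def)
        then show ?thesis using False by simp
      qed
    qed (intro Bochner_Integration.integrable_add G iE)+
    also have "\<dots> = measure M E + trunc_mgf N A (\<beta> - \<theta>) ^ n"
      using iE G by simp
    also have "trunc_mgf N A (\<beta> - \<theta>) ^ n \<le> (\<rho> * trunc_mgf N A \<beta>) ^ n"
      using low Z0 by (intro power_mono)
    finally have "trunc_mgf N A \<beta> ^ n \<le> measure M E + (\<rho> * trunc_mgf N A \<beta>) ^ n" by simp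
    moreover have "0 \<le> (\<rho> * trunc_mgf N A \<beta>) ^ n" using \<rho> Z0 by simp
    moreover have "b = 1" using True by (simp add: b_def)
    ultimately show ?thesis by simp
  next
    case False
    then have \<beta>: "\<beta> > 0" using \<rho> by simp
    define e where "e = exp (- (\<delta> * \<theta>)) ^ n"
    have e: "e = exp (- (\<theta> * (real n * \<delta>)))"
      by (simp add: e_def algebra_simps flip: exp_of_nat_mult)
    have bb: "b = exp (\<beta> * (real n * \<delta>))"
      by (simp add: b_def algebra_simps flip: exp_of_nat_mult)
    have "trunc_mgf N A \<beta> ^ n \<le> (\<integral>x. b * indicator E x + (G (\<beta> - \<theta>) x + e * G (\<beta> + \<theta>) x) \<partial>M)"
      unfolding G(2)[symmetric]
    proof (rule integral_mono)
      fix x assume x: "x \<in> space M"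
      let ?S = "\<Sum>i=1..n. Y i x"
      consider "?S < 0" | "0 \<le> ?S" "?S \<le> real n * \<delta>" | "0 \<le> ?S" "real n * \<delta> < ?S" by linarith
      then show "G \<beta> x \<le> b * indicator E x + (G (\<beta> - \<theta>) x + e * G (\<beta> + \<theta>) x)"
      proof cases
        case 1
        then have "G \<beta> x \<le> G (\<beta> - \<theta>) x" by (rule lowG)
        moreover have "0 \<le> b * indicator E x" "0 \<le> e * G (\<beta> + \<theta>) x"
          using b G0 by (simp_all add: e_def)
        ultimately show ?thesis by linarith
      next
        case 2
        then have "exp (\<beta> * ?S) \<le> b" using \<beta> by (simp add: bb)
        then have "G \<beta> x \<le> 1 * b" unfolding Gx using P01 by (intro mult_mono) auto
        moreover have "x \<in> E" using 2 x by (simp add: E_def)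
        moreover have "0 \<le> e * G (\<beta> + \<theta>) x" using G0 by (simp add: e_def)
        ultimately show ?thesis using G0[of "\<beta> - \<theta>" x] by simp
      next
        case 3
        have "\<theta> * (real n * \<delta>) \<le> \<theta> * ?S" using 3 \<rho> by (intro mult_left_mono) auto
        then have "exp (\<beta> * ?S) \<le> e * exp ((\<beta> + \<theta>) * ?S)"
          unfolding e exp_add[symmetric] by (simp add: algebra_simps)
        from mult_left_mono[OF this P01(1)[of x]]
        have "G \<beta> x \<le> e * G (\<beta> + \<theta>) x"
          unfolding Gx by (simp only: mult.left_commute)
        moreover have "0 \<le> b * indicator E x" using b by simp
        ultimately show ?thesis using G0[of "\<beta> - \<theta>" x] by linarith
      qed
    qed (intro Bochner_Integration.integrable_add integrable_mult_right G iE)+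
    also have "\<dots> = b * measure M E + (trunc_mgf N A (\<beta> - \<theta>) ^ n + e * trunc_mgf N A (\<beta> + \<theta>) ^ n)"
      using iE G by simp
    also have "e * trunc_mgf N A (\<beta> + \<theta>) ^ n = (exp (- (\<delta> * \<theta>)) * trunc_mgf N A (\<beta> + \<theta>)) ^ n"
      by (simp add: e_def power_mult_distrib)
    also have "\<dots> \<le> (\<rho> * trunc_mgf N A \<beta>) ^ n"
      using up[OF \<beta>] Z0 by (intro power_mono) auto
    also have "trunc_mgf N A (\<beta> - \<theta>) ^ n \<le> (\<rho> * trunc_mgf N A \<beta>) ^ n"
      using low Z0 by (intro power_mono)
    finally show ?thesis by simp
  qed
  have "b * ((exp (- (\<delta> * \<beta>)) * trunc_mgf N A \<beta>) ^ n * (1 - 2 * \<rho> ^ n)) =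
        trunc_mgf N A \<beta> ^ n - 2 * (\<rho> * trunc_mgf N A \<beta>) ^ n"
  proof -
    have "b * exp (- (\<delta> * \<beta>)) ^ n = 1"
      by (simp add: b_def flip: power_mult_distrib exp_add)
    moreover have "b * ((exp (- (\<delta> * \<beta>)) * trunc_mgf N A \<beta>) ^ n * (1 - 2 * \<rho> ^ n)) =
        (b * exp (- (\<delta> * \<beta>)) ^ n) * (trunc_mgf N A \<beta> ^ n - 2 * (\<rho> * trunc_mgf N A \<beta>) ^ n)"
      by (simp add: power_mult_distrib algebra_simps)
    ultimately show ?thesis by simp
  qed
  also have "\<dots> \<le> b * measure M E" using main by simp
  finally show ?thesis using b unfolding E_def by simp
qed

section \<open>Cramer's lower bound on the real line\<close>

text \<open>The shift by \<open>h\<close> makes the exponentially tilted mean equal to \<open>h > 0\<close> at a positive minimiser rather than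
  \<open>0\<close>, so that the tilted law puts the sum strictly inside \<open>(0, 2 h n)\<close>. The minimiser may be \<open>0\<close>: then the mean is
  at least \<open>h\<close> and only the lower tail matters.\<close>

lemma eventually_prob_ge_tilted_minimum:
  assumes "prob_space M" "prob_space.indep_vars M (\<lambda>_. borel) Y {1..}"
    and id: "\<And>i. i \<ge> 1 \<Longrightarrow> distr M borel (Y i) = N"
    and A: "A \<in> sets borel" "bounded A"
    and h: "h > 0" and \<beta>: "0 \<le> \<beta>" "\<beta> < a" and pos: "trunc_mgf N A \<beta> > 0"
    and min: "\<And>\<alpha>. 0 \<le> \<alpha> \<Longrightarrow> \<alpha> \<le> a \<Longrightarrow>
        exp (- (\<beta> * h)) * trunc_mgf N A \<beta> \<le> exp (- (\<alpha> * h)) * trunc_mgf N A \<alpha>"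
  shows "\<forall>\<^sub>F n in sequentially. (exp (- (2 * h * \<beta>)) * trunc_mgf N A \<beta>) ^ n / 2
    \<le> measure M {x \<in> space M. 0 \<le> (\<Sum>i=1..n. Y i x)}"
proof -
  interpret prob_space M by fact
  have m: "random_variable borel (Y i)" if "i \<ge> 1" for i
    using assms(2) that by (auto simp: indep_vars_def)
  have N: "finite_measure N" "sets N = sets borel"
    using id[of 1] m[of 1] by (auto intro!: prob_space.finite_measure prob_space_distr)
  obtain R0 where R0: "\<And>y. y \<in> A \<Longrightarrow> \<bar>y\<bar> \<le> R0"
    using A(2) by (auto simp: bounded_iff)
  define R where "R = \<bar>R0\<bar> + h + 1"
  have R: "\<bar>y - h\<bar> \<le> R" if "y \<in> A" for y using R0[OF that] h by (simp add: R_def)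
  have "R > 0" using h by (simp add: R_def)
  (* The bounds on \<theta> allow trunc_mgf_second_difference, keep \<beta> + \<theta> and (for \<beta> > 0) \<beta> - \<theta> in the
     range where \<beta> is minimal, and make the gain exp (- (\<theta> * h)) beat the loss 1 + 2 * (\<theta> * R)^2. *)
  define \<theta> where "\<theta> = Min {1 / R, a - \<beta>, (if \<beta> > 0 then \<beta> else 1), h / (4 * R\<^sup>2)}"
  have \<theta>: "\<theta> > 0" "\<theta> \<le> 1 / R" "\<theta> \<le> a - \<beta>" "\<beta> > 0 \<Longrightarrow> \<theta> \<le> \<beta>" "\<theta> \<le> h / (4 * R\<^sup>2)"
    using h \<beta> \<open>R > 0\<close> by (auto simp: \<theta>_def)
  have \<theta>R: "\<theta> * R \<le> 1" using \<theta>(2) \<open>R > 0\<close> by (simp add: field_simps)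
  define q where "q = 1 + 2 * (\<theta> * R)\<^sup>2"
  define \<rho> where "\<rho> = exp (- (\<theta> * h)) * q"
  have sd: "exp (- (\<theta> * h)) * trunc_mgf N A (\<beta> + \<theta>) + exp (\<theta> * h) * trunc_mgf N A (\<beta> - \<theta>)
      \<le> (2 + 2 * (\<theta> * R)\<^sup>2) * trunc_mgf N A \<beta>"
    using \<theta>(1) by (intro trunc_mgf_second_difference[OF N A R _ \<theta>R]) auto
  have right: "trunc_mgf N A \<beta> \<le> exp (- (\<theta> * h)) * trunc_mgf N A (\<beta> + \<theta>)"
  proof -
    have "exp (\<beta> * h) * (exp (- (\<beta> * h)) * trunc_mgf N A \<beta>)
        \<le> exp (\<beta> * h) * (exp (- ((\<beta> + \<theta>) * h)) * trunc_mgf N A (\<beta> + \<theta>))"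
      using \<theta> \<beta> by (intro mult_left_mono min) auto
    moreover have "exp (\<beta> * h) * exp (- (\<beta> * h)) = 1"
      by (simp flip: exp_add)
    moreover have "exp (\<beta> * h) * exp (- ((\<beta> + \<theta>) * h)) = exp (- (\<theta> * h))"
      unfolding exp_add[symmetric] by (simp add: algebra_simps)
    ultimately show ?thesis by (simp only: mult.assoc[symmetric] mult_1_left)
  qed
  have left: "trunc_mgf N A \<beta> \<le> exp (\<theta> * h) * trunc_mgf N A (\<beta> - \<theta>)" if "\<beta> > 0"
  proof -
    have "exp (\<beta> * h) * (exp (- (\<beta> * h)) * trunc_mgf N A \<beta>)
        \<le> exp (\<beta> * h) * (exp (- ((\<beta> - \<theta>) * h)) * trunc_mgf N A (\<beta> - \<theta>))"
      using \<theta> \<beta> that by (intro mult_left_mono min) auto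
    moreover have "exp (\<beta> * h) * exp (- (\<beta> * h)) = 1"
      by (simp flip: exp_add)
    moreover have "exp (\<beta> * h) * exp (- ((\<beta> - \<theta>) * h)) = exp ((\<theta> * h))"
      unfolding exp_add[symmetric] by (simp add: algebra_simps)
    ultimately show ?thesis by (simp only: mult.assoc[symmetric] mult_1_left)
  qed
  have low: "trunc_mgf N A (\<beta> - \<theta>) \<le> \<rho> * trunc_mgf N A \<beta>"
  proof -
    have "exp (\<theta> * h) * trunc_mgf N A (\<beta> - \<theta>) \<le> q * trunc_mgf N A \<beta>"
      using sd right by (simp add: q_def algebra_simps)
    then have "exp (- (\<theta> * h)) * (exp (\<theta> * h) * trunc_mgf N A (\<beta> - \<theta>))
        \<le> exp (- (\<theta> * h)) * (q * trunc_mgf N A \<beta>)" by (intro mult_left_mono) auto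
    moreover have "exp (- (\<theta> * h)) * exp (\<theta> * h) = 1" by (simp flip: exp_add)
    ultimately show ?thesis unfolding \<rho>_def by (simp only: mult.assoc[symmetric] mult_1_left)
  qed
  have up: "exp (- (2 * h * \<theta>)) * trunc_mgf N A (\<beta> + \<theta>) \<le> \<rho> * trunc_mgf N A \<beta>" if "\<beta> > 0"
  proof -
    have "exp (- (\<theta> * h)) * trunc_mgf N A (\<beta> + \<theta>) \<le> q * trunc_mgf N A \<beta>"
      using sd left[OF that] by (simp add: q_def algebra_simps)
    then have "exp (- (\<theta> * h)) * (exp (- (\<theta> * h)) * trunc_mgf N A (\<beta> + \<theta>))
        \<le> exp (- (\<theta> * h)) * (q * trunc_mgf N A \<beta>)" by (intro mult_left_mono) auto
    moreover have "exp (- (\<theta> * h)) * exp (- (\<theta> * h)) = exp (- (2 * h * \<theta>))"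
      unfolding exp_add[symmetric] by (simp add: algebra_simps)
    ultimately show ?thesis unfolding \<rho>_def by (simp only: mult.assoc[symmetric])
  qed
  have "2 * (\<theta> * R)\<^sup>2 = \<theta> * (\<theta> * (2 * R\<^sup>2))" by (simp add: power2_eq_square)
  also have "\<dots> \<le> \<theta> * (h / (4 * R\<^sup>2) * (2 * R\<^sup>2))"
    using \<theta> by (intro mult_left_mono mult_right_mono) auto
  also have "\<dots> = \<theta> * h / 2" using \<open>R > 0\<close> by simp
  also have "\<dots> < \<theta> * h" using \<theta>(1) h by simp
  finally have "q < 1 + \<theta> * h" by (simp add: q_def)
  also have "\<dots> \<le> exp (\<theta> * h)" by (rule exp_ge_add_one_self)
  finally have "q < exp (\<theta> * h)" .
  then have \<rho>: "0 \<le> \<rho>" "\<rho> < 1"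
    by (auto simp: \<rho>_def q_def exp_minus field_simps)
  have "(\<lambda>n. 1 - 2 * \<rho> ^ n) \<longlonglongrightarrow> 1 - 2 * 0"
    by (intro tendsto_intros LIMSEQ_realpow_zero \<rho>)
  then have "\<forall>\<^sub>F n in sequentially. 1 / 2 < 1 - 2 * \<rho> ^ n"
    by (rule order_tendstoD) simp
  then show ?thesis
  proof eventually_elim
    case (elim n)
    have "(exp (- (2 * h * \<beta>)) * trunc_mgf N A \<beta>) ^ n * (1 / 2)
        \<le> (exp (- (2 * h * \<beta>)) * trunc_mgf N A \<beta>) ^ n * (1 - 2 * \<rho> ^ n)"
      using elim pos by (intro mult_left_mono) auto
    also have "\<dots> \<le> measure M {x \<in> space M. 0 \<le> (\<Sum>i=1..n. Y i x)}"
      using \<theta>(1) \<beta> \<rho> by (intro prob_nonneg_sum_ge_trunc_mgf[OF assms(1,2) id A _ _ _ low up]) auto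
    finally show ?case by simp
  qed
qed

lemma trunc_mgf_exceeds_somewhere:
  assumes "finite_measure N" "sets N = sets borel"
    and "ennreal \<kappa> < (\<integral>\<^sup>+y. ennreal (exp (\<alpha> * y)) \<partial>N)" "0 \<le> \<kappa>"
  shows "\<exists>k::nat. \<kappa> < trunc_mgf N {- real k..real k} \<alpha>"
proof -
  note [measurable_cong] = assms(2)
  have nn: "(\<integral>\<^sup>+y. ennreal (indicator {- real k..real k} y * exp (\<alpha> * y)) \<partial>N)
      = ennreal (trunc_mgf N {- real k..real k} \<alpha>)" for k :: nat
    unfolding trunc_mgf_def
    by (intro nn_integral_eq_integral trunc_mgf_integrable assms) auto
  have "(SUP k::nat. ennreal (indicator {- real k..real k} y * exp (\<alpha> * y))) = ennreal (exp (\<alpha> * y))" for y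
  proof (rule antisym)
    obtain k :: nat where "\<bar>y\<bar> \<le> real k" using real_arch_simple by blast
    then show "ennreal (exp (\<alpha> * y)) \<le> (SUP k::nat. ennreal (indicator {- real k..real k} y * exp (\<alpha> * y)))"
      by (intro SUP_upper2[of k]) (auto simp: indicator_def)
  qed (auto intro!: SUP_least simp: indicator_def)
  then have "(\<integral>\<^sup>+y. ennreal (exp (\<alpha> * y)) \<partial>N)
      = (\<integral>\<^sup>+y. (SUP k::nat. ennreal (indicator {- real k..real k} y * exp (\<alpha> * y))) \<partial>N)" by simp
  also have "\<dots> = (SUP k::nat. \<integral>\<^sup>+y. ennreal (indicator {- real k..real k} y * exp (\<alpha> * y)) \<partial>N)"
    by (intro nn_integral_monotone_convergence_SUP incseq_SucI le_funI)
       (auto simp: indicator_def)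
  finally have "ennreal \<kappa> < (SUP k::nat. ennreal (trunc_mgf N {- real k..real k} \<alpha>))"
    using assms(3) by (simp only: nn)
  then show ?thesis using \<open>0 \<le> \<kappa>\<close> by (auto simp: less_SUP_iff ennreal_less_iff)
qed

text \<open>Dini's argument: the truncated functions are continuous and increase with \<open>k\<close> to a limit above
  \<open>\<kappa>\<close>, so the open sets on which they exceed \<open>\<kappa>\<close> cover the compact interval increasingly. The limit may be
  infinite.\<close>

lemma trunc_mgf_exceeds_uniformly:
  assumes N: "finite_measure N" "sets N = sets borel"
    and \<kappa>: "\<And>\<alpha>. 0 \<le> \<alpha> \<Longrightarrow> ennreal \<kappa> < (\<integral>\<^sup>+y. ennreal (exp (\<alpha> * y)) \<partial>N)" "0 \<le> \<kappa>"
  shows "\<exists>k::nat. k \<ge> k0 \<and> (\<forall>\<alpha>. 0 \<le> \<alpha> \<longrightarrow> \<alpha> \<le> a \<longrightarrow> \<kappa> < trunc_mgf N {- real k..real k} \<alpha>)"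
proof -
  let ?U = "\<lambda>k::nat. {\<alpha>. \<kappa> < trunc_mgf N {- real k..real k} \<alpha>}"
  have op: "open (?U k)" for k
    using continuous_on_trunc_mgf[OF N, of "{- real k..real k}"]
    by (intro open_Collect_less) auto
  have "{0..a} \<subseteq> (\<Union>k\<in>UNIV. ?U k)"
    using trunc_mgf_exceeds_somewhere[OF N \<kappa>(1) \<kappa>(2)] by auto
  from compactE_image[OF compact_Icc op this]
  obtain C where C: "finite C" "{0..a} \<subseteq> (\<Union>k\<in>C. ?U k)" by metis
  define k where "k = Max (insert k0 C)"
  have "\<kappa> < trunc_mgf N {- real k..real k} \<alpha>" if \<alpha>: "0 \<le> \<alpha>" "\<alpha> \<le> a" for \<alpha>
  proof -
    obtain j where j: "j \<in> C" "\<kappa> < trunc_mgf N {- real j..real j} \<alpha>"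
      using C(2) \<alpha> by fastforce
    have "j \<le> k" using j C(1) by (auto simp: k_def)
    then have "trunc_mgf N {- real j..real j} \<alpha> \<le> trunc_mgf N {- real k..real k} \<alpha>"
      by (intro trunc_mgf_mono N) auto
    with j show ?thesis by simp
  qed
  moreover have "k \<ge> k0" using C(1) by (simp add: k_def)
  ultimately show ?thesis by blast
qed

text \<open>For nonpositive summands the infimum of the moment generating function is approached as
  \<open>\<alpha> \<rightarrow> \<infinity>\<close> and equals the mass at \<open>0\<close>, while the sum is nonnegative as soon as all summands vanish.\<close>

lemma cramer_lower_bound_nonpos:
  assumes "prob_space M" "prob_space.indep_vars M (\<lambda>_. borel) Y {1..}"
    and id: "\<And>i. i \<ge> 1 \<Longrightarrow> distr M borel (Y i) = N"
    and np: "emeasure N {0<..} = 0"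
    and \<kappa>: "\<And>\<alpha>. 0 \<le> \<alpha> \<Longrightarrow> ennreal \<kappa> \<le> (\<integral>\<^sup>+y. ennreal (exp (\<alpha> * y)) \<partial>N)" "0 \<le> \<kappa>"
  shows "\<kappa> ^ n \<le> measure M {x \<in> space M. 0 \<le> (\<Sum>i=1..n. Y i x)}"
proof -
  interpret prob_space M by fact
  have m[measurable]: "random_variable borel (Y i)" if "i \<ge> 1" for i
    using assms(2) that by (auto simp: indep_vars_def)
  have N: "prob_space N" "sets N = sets borel"
    using id[of 1] m[of 1] by (auto intro!: prob_space_distr)
  interpret N: prob_space N by fact
  note [measurable_cong] = N(2)
  have ae: "AE y in N. y \<le> 0"
    using np by (subst AE_iff_measurable[of "{0<..}"]) (auto simp: N(2) sets_eq_imp_space_eq[OF N(2)])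
  have lim: "(\<lambda>k. \<integral>y. exp (real k * y) \<partial>N) \<longlonglongrightarrow> (\<integral>y. indicator {0} y \<partial>N)"
  proof (rule integral_dominated_convergence[where w="\<lambda>_. 1"])
    show "AE y in N. (\<lambda>k. exp (real k * y)) \<longlonglongrightarrow> indicator {0} y"
      using ae
    proof eventually_elim
      case (elim y)
      show ?case
      proof (cases "y = 0")
        case False
        then have "exp y < 1" using elim by simp
        then have "(\<lambda>k. exp y ^ k) \<longlonglongrightarrow> 0" by (intro LIMSEQ_realpow_zero) auto
        then show ?thesis using False by (simp add: exp_of_nat_mult)
      qed simp
    qed
    show "AE y in N. norm (exp (real k * y)) \<le> 1" for k
      using ae by eventually_elim (auto simp: mult_nonneg_nonpos)
  qed auto
  have "\<kappa> \<le> (\<integral>y. exp (real k * y) \<partial>N)" for k :: nat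
  proof -
    have "AE y in N. norm (exp (real k * y)) \<le> 1"
      using ae by eventually_elim (auto simp: mult_nonneg_nonpos)
    then have "integrable N (\<lambda>y. exp (real k * y))"
      by (intro N.integrable_const_bound[where B=1]) auto
    then have "(\<integral>\<^sup>+y. ennreal (exp (real k * y)) \<partial>N) = ennreal (\<integral>y. exp (real k * y) \<partial>N)"
      by (intro nn_integral_eq_integral) auto
    then show ?thesis using \<kappa>(1)[of "real k"] by (simp add: ennreal_le_iff integral_nonneg_AE)
  qed
  then have \<kappa>0: "\<kappa> \<le> (\<integral>y. indicator {0} y \<partial>N)"
    by (intro LIMSEQ_le_const[OF lim]) auto
  have iI: "integrable N (indicator {0} :: real \<Rightarrow> real)"
    by (intro integrable_real_indicator) (auto simp: N(2) less_top[symmetric])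
  note iid = iid_prod_expectation[OF assms(1,2) id _ iI, of n]
  have iE: "integrable M (indicator {x \<in> space M. 0 \<le> (\<Sum>i=1..n. Y i x)} :: _ \<Rightarrow> real)"
    by (intro integrable_real_indicator) (auto simp: less_top[symmetric])
  have "\<kappa> ^ n \<le> (\<integral>y. indicator {0} y \<partial>N) ^ n" using \<kappa>0 \<kappa>(2) by (rule power_mono)
  also have "\<dots> = (\<integral>x. (\<Prod>i=1..n. indicator {0} (Y i x)) \<partial>M)"
    using iid(2) by simp
  also have "\<dots> \<le> (\<integral>x. indicator {x \<in> space M. 0 \<le> (\<Sum>i=1..n. Y i x)} x \<partial>M)"
  proof (rule integral_mono)
    fix x assume x: "x \<in> space M"
    show "(\<Prod>i=1..n. indicator {0} (Y i x)) \<le>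
        (indicator {x \<in> space M. 0 \<le> (\<Sum>i=1..n. Y i x)} x :: real)"
    proof (cases "\<forall>i\<in>{1..n}. Y i x = 0")
      case True
      then show ?thesis using x by simp
    next
      case False
      then have "(\<Prod>i=1..n. indicator {0} (Y i x)) = (0::real)"
        by (intro prod_zero) (auto simp: indicator_def)
      then show ?thesis by (simp only: indicator_pos_le)
    qed
  qed (use iid(1) iE in auto)
  also have "\<dots> = measure M {x \<in> space M. 0 \<le> (\<Sum>i=1..n. Y i x)}" by simp
  finally show ?thesis .
qed

text \<open>Cramer's lower bound for the half-line \<open>[0, \<infinity>)\<close> for an arbitrary law \<open>N\<close>. If \<open>N\<close> charges
  \<open>(0, \<infinity>)\<close>, the truncated functions grow exponentially from some truncation level on, so all their
  minimisers lie in one interval \<open>[0, a)\<close>; on it one truncation is uniformly good, and the loss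
  \<open>e\<^bsup>-2 h \<beta>\<^esup> \<ge> e\<^bsup>-2 h a\<^esup>\<close> from the shift is made harmless by a small \<open>h\<close>.\<close>

theorem cramer_lower_bound:
  assumes "prob_space M" "prob_space.indep_vars M (\<lambda>_. borel) Y {1..}"
    and id: "\<And>i. i \<ge> 1 \<Longrightarrow> distr M borel (Y i) = N"
    and \<kappa>: "\<And>\<alpha>. 0 \<le> \<alpha> \<Longrightarrow> ennreal \<kappa> \<le> (\<integral>\<^sup>+y. ennreal (exp (\<alpha> * y)) \<partial>N)"
    and \<kappa>': "0 < \<kappa>'" "\<kappa>' < \<kappa>"
  shows "\<forall>\<^sub>F n in sequentially. \<kappa>' ^ n \<le> measure M {x \<in> space M. 0 \<le> (\<Sum>i=1..n. Y i x)}"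
proof -
  interpret prob_space M by fact
  have m: "random_variable borel (Y i)" if "i \<ge> 1" for i
    using assms(2) that by (auto simp: indep_vars_def)
  have N: "prob_space N" "sets N = sets borel"
    using id[of 1] m[of 1] by (auto intro!: prob_space_distr)
  interpret N: prob_space N by fact
  note [measurable_cong] = N(2)
  have fN: "finite_measure N" by (rule N.finite_measure)
  show ?thesis
  proof (cases "emeasure N {0<..} = 0")
    case True
    have "\<kappa>' ^ n \<le> measure M {x \<in> space M. 0 \<le> (\<Sum>i=1..n. Y i x)}" for n
    proof -
      have "\<kappa>' ^ n \<le> \<kappa> ^ n" using \<kappa>' by (intro power_mono) auto
      also have "\<dots> \<le> measure M {x \<in> space M. 0 \<le> (\<Sum>i=1..n. Y i x)}"
        using \<kappa>' by (intro cramer_lower_bound_nonpos[OF assms(1,2) id True \<kappa>]) auto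
      finally show ?thesis .
    qed
    then show ?thesis by simp
  next
    case False
    have U: "(\<Union>j::nat. {1 / real (Suc j)<..real (Suc j)}) = {0::real<..}"
    proof (intro set_eqI iffI)
      fix y :: real assume "y \<in> {0<..}"
      then have y: "y > 0" by simp
      obtain j1 where j1: "1 / real (Suc j1) < y" using y nat_approx_posE by blast
      obtain j2 :: nat where j2: "y \<le> real j2" using real_arch_simple by blast
      let ?j = "max j1 j2"
      have "1 / real (Suc ?j) \<le> 1 / real (Suc j1)" by (intro divide_left_mono) auto
      moreover have "y \<le> real (Suc ?j)" using j2 by simp
      ultimately show "y \<in> (\<Union>j::nat. {1 / real (Suc j)<..real (Suc j)})" using j1
        by (intro UN_I[of ?j]) (auto simp del: of_nat_Suc)
    qed (auto intro: order.strict_trans[rotated])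
    have "\<exists>j::nat. emeasure N {1 / real (Suc j)<..real (Suc j)} \<noteq> 0"
    proof (rule ccontr)
      assume "\<not> ?thesis"
      then have "emeasure N (\<Union>j::nat. {1 / real (Suc j)<..real (Suc j)}) = 0"
        by (intro emeasure_UN_eq_0) (auto simp: N(2))
      then show False using False by (simp only: U)
    qed
    then obtain j :: nat where j: "emeasure N {1 / real (Suc j)<..real (Suc j)} \<noteq> 0" by blast
    define \<eta> where "\<eta> = 1 / real (Suc j)"
    define p where "p = measure N {\<eta><..real (Suc j)}"
    have \<eta>: "\<eta> > 0" by (simp add: \<eta>_def)
    have p: "p > 0" using j unfolding p_def \<eta>_def by (simp add: N.emeasure_eq_measure zero_less_measure_iff)
    (* By 1 + x \<le> exp x this choice gives exp (a * \<eta> / 2) * p > 1, so the function to be minimised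
       is larger at a than at 0. *)
    define a where "a = 2 / (\<eta> * p)"
    have a: "a > 0" using \<eta> p by (simp add: a_def)
    define \<kappa>1 where "\<kappa>1 = (\<kappa>' + \<kappa>) / 2"
    have \<kappa>1: "\<kappa>' < \<kappa>1" "\<kappa>1 < \<kappa>" "0 < \<kappa>1" using \<kappa>' by (auto simp: \<kappa>1_def)
    have "((\<lambda>h. exp (- (2 * h * a)) * \<kappa>1) \<longlongrightarrow> exp (- (2 * 0 * a)) * \<kappa>1) (at_right 0)"
      by (intro tendsto_intros)
    then have "\<forall>\<^sub>F h in at_right 0. \<kappa>' < exp (- (2 * h * a)) * \<kappa>1"
      by (rule order_tendstoD) (simp add: \<kappa>1)
    moreover have "\<forall>\<^sub>F h in at_right 0. h \<in> {0<..<\<eta> / 2}"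
      using \<eta> by (intro eventually_at_right_real) simp
    ultimately have "\<forall>\<^sub>F h in at_right (0::real). \<kappa>' < exp (- (2 * h * a)) * \<kappa>1 \<and> h \<in> {0<..<\<eta> / 2}"
      by (rule eventually_conj)
    then obtain h where h: "\<kappa>' < exp (- (2 * h * a)) * \<kappa>1" "0 < h" "h < \<eta> / 2"
      using eventually_happens trivial_limit_at_right_real by (metis (no_types, lifting) greaterThanLessThan_iff)
    have "ennreal \<kappa>1 < ennreal \<kappa>" using \<kappa>1 by (simp add: ennreal_less_iff)
    then have "ennreal \<kappa>1 < (\<integral>\<^sup>+y. ennreal (exp (\<alpha> * y)) \<partial>N)" if "0 \<le> \<alpha>" for \<alpha>
      using \<kappa>[OF that] by (rule order.strict_trans2)
    from trunc_mgf_exceeds_uniformly[OF fN N(2) this, of "Suc j" a] \<kappa>1(3)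
    obtain k :: nat where k: "k \<ge> Suc j"
      "\<And>\<alpha>. 0 \<le> \<alpha> \<Longrightarrow> \<alpha> \<le> a \<Longrightarrow> \<kappa>1 < trunc_mgf N {- real k..real k} \<alpha>" by auto
    define A where "A = {- real k..real k}"
    have A: "A \<in> sets borel" "bounded A" by (auto simp: A_def)
    define \<Phi> where "\<Phi> \<alpha> = exp (- (\<alpha> * h)) * trunc_mgf N A \<alpha>" for \<alpha>
    have "continuous_on {0..a} \<Phi>" unfolding \<Phi>_def
      by (intro continuous_intros continuous_on_subset[OF continuous_on_trunc_mgf[OF fN N(2) A]]) auto
    then obtain \<beta> where \<beta>: "\<beta> \<in> {0..a}" "\<And>\<alpha>. \<alpha> \<in> {0..a} \<Longrightarrow> \<Phi> \<beta> \<le> \<Phi> \<alpha>"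
      using continuous_attains_inf[of "{0..a}" \<Phi>] a by auto
    have "\<Phi> 0 \<le> 1"
    proof -
      have "trunc_mgf N A 0 = measure N A"
        by (simp add: trunc_mgf_def sets_eq_imp_space_eq[OF N(2)])
      then show ?thesis by (simp add: \<Phi>_def)
    qed
    moreover have "1 < \<Phi> a"
    proof -
      have "exp (a * \<eta>) * p = (\<integral>y. exp (a * \<eta>) * indicator {\<eta><..real (Suc j)} y \<partial>N)"
        by (simp add: p_def N(2))
      also have "\<dots> \<le> trunc_mgf N A a" unfolding trunc_mgf_def
      proof (rule integral_mono)
        show "integrable N (\<lambda>y. exp (a * \<eta>) * indicator {\<eta><..real (Suc j)} y)"
          by (intro integrable_mult_right integrable_real_indicator) (auto simp: N(2) less_top[symmetric])
        show "exp (a * \<eta>) * indicator {\<eta><..real (Suc j)} y \<le> indicator A y * exp (a * y)" for y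
          using a \<eta> k(1) by (auto simp: A_def indicator_def)
      qed (rule trunc_mgf_integrable[OF fN N(2) A])
      finally have 1: "exp (a * \<eta>) * p \<le> trunc_mgf N A a" .
      have "1 < (1 + a * (\<eta> / 2)) * p" using \<eta> p by (simp add: a_def field_simps)
      also have "\<dots> \<le> exp (a * (\<eta> / 2)) * p" using p by (intro mult_right_mono exp_ge_add_one_self) auto
      also have "\<dots> = exp (- (a * (\<eta> / 2))) * (exp (a * \<eta>) * p)"
        unfolding mult.assoc[symmetric] exp_add[symmetric] by (simp add: algebra_simps)
      also have "\<dots> \<le> exp (- (a * h)) * trunc_mgf N A a"
        using 1 h a p by (intro mult_mono) auto
      finally show ?thesis by (simp add: \<Phi>_def)
    qed
    ultimately have "\<beta> \<noteq> a" using \<beta>(2)[of 0] a by auto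
    then have \<beta>': "0 \<le> \<beta>" "\<beta> < a" using \<beta>(1) by auto
    define c where "c = exp (- (2 * h * \<beta>)) * trunc_mgf N A \<beta>"
    have tb: "\<kappa>1 < trunc_mgf N A \<beta>" unfolding A_def using k(2) \<beta>' by simp
    have "\<forall>\<^sub>F n in sequentially. c ^ n / 2 \<le> measure M {x \<in> space M. 0 \<le> (\<Sum>i=1..n. Y i x)}"
      unfolding c_def using \<beta> tb \<kappa>1(3)
      by (intro eventually_prob_ge_tilted_minimum[OF assms(1,2) id A h(2) \<beta>']) (auto simp: \<Phi>_def)
    moreover have "\<forall>\<^sub>F n in sequentially. \<kappa>' ^ n \<le> c ^ n / 2"
    proof -
      have "\<kappa>' < exp (- (2 * h * a)) * \<kappa>1" by (rule h)
      also have "\<dots> \<le> c" unfolding c_def using tb \<beta>' h \<kappa>1 by (intro mult_mono) auto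
      finally have "\<kappa>' < c" .
      then have "(\<lambda>n. (\<kappa>' / c) ^ n) \<longlonglongrightarrow> 0" using \<kappa>' by (intro LIMSEQ_realpow_zero) auto
      then have "\<forall>\<^sub>F n in sequentially. (\<kappa>' / c) ^ n < 1 / 2" by (rule order_tendstoD) simp
      then show ?thesis
      proof eventually_elim
        case (elim n)
        then show ?case using \<open>\<kappa>' < c\<close> \<kappa>' by (simp add: power_divide field_simps)
      qed
    qed
    ultimately show ?thesis by eventually_elim auto
  qed
qed

section \<open>Chernoff bound at a default time\<close>

lemma net_loss_altdef:
  "net_loss r \<tau> l s = (if \<tau> \<le> s then l else 0) - r * min \<tau> s"
  by (simp add: net_loss_def)

text \<open>\<open>F(T)\<close> is stochastically at least uniform for every law. A compact subset of \<open>{F \<le> x}\<close> lies below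
  its maximum \<open>b\<close>, so its mass is at most \<open>F(b) \<le> x\<close>; inner regularity does the rest.\<close>

lemma prob_cdf_le:
  fixes D :: "real measure"
  assumes "prob_space D" "sets D = sets borel" "0 \<le> x"
  shows "emeasure D {v. measure D {..v} \<le> x} \<le> ennreal x"
proof -
  interpret prob_space D by fact
  note [measurable_cong] = assms(2)
  have mono: "mono (\<lambda>v. measure D {..v})"
    by (intro monoI finite_measure_mono) (auto simp: assms(2))
  have [measurable]: "(\<lambda>v. measure D {..v}) \<in> borel_measurable borel"
    by (rule borel_measurable_mono[OF mono])
  let ?S = "{v. measure D {..v} \<le> x}"
  have "emeasure D ?S = (SUP K\<in>{K. K \<subseteq> ?S \<and> compact K}. emeasure D K)"
    by (rule inner_regular) (auto simp: assms(2))
  also have "\<dots> \<le> ennreal x"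
  proof (rule SUP_least)
    fix K assume K: "K \<in> {K. K \<subseteq> ?S \<and> compact K}"
    show "emeasure D K \<le> ennreal x"
    proof (cases "K = {}")
      case False
      then obtain b where b: "b \<in> K" "\<And>v. v \<in> K \<Longrightarrow> v \<le> b"
        using K compact_attains_sup[of K] by blast
      then have "emeasure D K \<le> emeasure D {..b}"
        by (intro emeasure_mono) (auto simp: assms(2))
      also have "\<dots> \<le> ennreal x"
        using b(1) K by (auto simp: emeasure_eq_measure intro: ennreal_leI)
      finally show ?thesis .
    qed simp
  qed
  finally show ?thesis .
qed

text \<open>The integrand is at most \<open>min 1 (e\<^bsup>-c\<^esup> / F)\<close>. On the layer \<open>e\<^bsup>-k-1\<^esup> < F \<le> e\<^bsup>-k\<^esup>\<close>, whose mass is at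
  most \<open>e\<^bsup>-k\<^esup>\<close>, this is at most \<open>e\<^bsup>k+1-c\<^esup>\<close>: each layer contributes \<open>e\<^bsup>1-c\<^esup>\<close>, and about \<open>c\<close> layers lie
  above \<open>F = e\<^bsup>-c\<^esup>\<close>.\<close>

lemma nn_integral_truncated_inverse_cdf:
  fixes D :: "real measure" and b :: "real \<Rightarrow> ennreal"
  assumes "prob_space D" "sets D = sets borel" "0 \<le> c"
    and b1: "\<And>v. b v \<le> 1"
    and bF: "\<And>v. ennreal (measure D {..v}) * b v \<le> ennreal (exp (- c))"
  shows "(\<integral>\<^sup>+v. b v \<partial>D) \<le> ennreal (exp (- c) * (1 + exp 1 * (c + 2)))"
proof -
  interpret prob_space D by fact
  note [measurable_cong] = assms(2)
  define F where "F v = measure D {..v}" for v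
  have mono: "mono F" unfolding F_def
    by (intro monoI finite_measure_mono) (auto simp: assms(2))
  have [measurable]: "F \<in> borel_measurable borel"
    by (rule borel_measurable_mono[OF mono])
  define m where "m = nat \<lceil>c\<rceil>"
  have m: "c \<le> real m" "real m \<le> c + 1" using \<open>0 \<le> c\<close> unfolding m_def by linarith+
  let ?S = "\<lambda>x. {v. F v \<le> x}"
  have S: "emeasure D (?S x) \<le> ennreal x" if "0 \<le> x" for x
    using prob_cdf_le[OF assms(1,2) that] by (simp add: F_def)
  have maj: "b v \<le> indicator (?S (exp (- c))) v
      + (\<Sum>k\<le>m. ennreal (exp (real k + 1 - c)) * indicator (?S (exp (- real k))) v)" for v
  proof (cases "F v \<le> exp (- c)")
    case True
    then show ?thesis using b1[of v] by (simp add: add_increasing2)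
  next
    case False
    have F: "0 < F v" "F v \<le> 1"
      using False less_trans[OF exp_gt_zero, of "- c" "F v"] by (auto simp: F_def)
    define k where "k = nat \<lfloor>- ln (F v)\<rfloor>"
    have "0 \<le> - ln (F v)" using F by simp
    then have k: "real k \<le> - ln (F v)" "- ln (F v) < real k + 1"
      unfolding k_def by linarith+
    have "- ln (F v) < c" using False F by (metis exp_le_cancel_iff exp_ln linorder_not_le minus_less_iff neg_less_iff_less)
    then have "k \<le> m" using k(1) m(1) by linarith
    have "ln (F v) \<le> - real k" using k(1) by simp
    then have vk: "F v \<le> exp (- real k)" using F by (metis exp_le_cancel_iff exp_ln)
    have "- (real k + 1) < ln (F v)" using k(2) by simp
    then have lk: "exp (- (real k + 1)) < F v" using F by (metis exp_less_cancel_iff exp_ln)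
    have "b v = ennreal (1 / F v) * (ennreal (F v) * b v)"
      using F by (simp add: mult.assoc[symmetric] ennreal_mult[symmetric])
    also have "\<dots> \<le> ennreal (1 / F v) * ennreal (exp (- c))"
      using bF[of v] unfolding F_def[symmetric] by (intro mult_left_mono) auto
    also have "\<dots> = ennreal (exp (- c) / F v)" using F by (simp add: ennreal_mult[symmetric])
    also have "\<dots> \<le> ennreal (exp (- c) / exp (- (real k + 1)))"
      using F lk by (intro ennreal_leI divide_left_mono) auto
    also have "\<dots> = ennreal (exp (real k + 1 - c)) * indicator (?S (exp (- real k))) v"
      using vk by (simp flip: exp_diff)
    also have "\<dots> \<le> (\<Sum>k\<le>m. ennreal (exp (real k + 1 - c)) * indicator (?S (exp (- real k))) v)"
      using \<open>k \<le> m\<close> by (intro member_le_sum) auto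
    finally show ?thesis by (simp add: add_increasing)
  qed
  have "(\<integral>\<^sup>+v. b v \<partial>D) \<le> (\<integral>\<^sup>+v. indicator (?S (exp (- c))) v
      + (\<Sum>k\<le>m. ennreal (exp (real k + 1 - c)) * indicator (?S (exp (- real k))) v) \<partial>D)"
    by (intro nn_integral_mono maj)
  also have "\<dots> = emeasure D (?S (exp (- c)))
      + (\<Sum>k\<le>m. ennreal (exp (real k + 1 - c)) * emeasure D (?S (exp (- real k))))"
  proof -
    have S_sets: "?S x \<in> sets D" for x
      using borel_measurable_le[OF \<open>F \<in> borel_measurable borel\<close> borel_measurable_const, of x]
      by (simp add: assms(2))
    have m1: "indicator (?S x) \<in> borel_measurable D" for x
      by (rule borel_measurable_indicator[OF S_sets])
    have m2: "(\<lambda>v. ennreal a * indicator (?S x) v) \<in> borel_measurable D" for a x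
      by (rule borel_measurable_times_ennreal[OF borel_measurable_const m1])
    have "(\<integral>\<^sup>+v. (\<Sum>k\<le>m. ennreal (exp (real k + 1 - c)) * indicator (?S (exp (- real k))) v) \<partial>D)
        = (\<Sum>k\<le>m. \<integral>\<^sup>+v. ennreal (exp (real k + 1 - c)) * indicator (?S (exp (- real k))) v \<partial>D)"
      by (rule nn_integral_sum[OF m2])
    also have "\<dots> = (\<Sum>k\<le>m. ennreal (exp (real k + 1 - c)) * emeasure D (?S (exp (- real k))))"
      by (intro sum.cong refl nn_integral_cmult_indicator S_sets)
    finally show ?thesis
      using nn_integral_add[OF m1 borel_measurable_sum[OF m2]] nn_integral_indicator[OF S_sets] by metis
  qed
  also have "\<dots> \<le> ennreal (exp (- c)) + (\<Sum>k\<le>m. ennreal (exp (real k + 1 - c)) * ennreal (exp (- real k)))"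
    by (intro add_mono sum_mono mult_left_mono S) auto
  also have "(\<Sum>k\<le>m. ennreal (exp (real k + 1 - c)) * ennreal (exp (- real k))) = (\<Sum>k\<le>m. ennreal (exp (1 - c)))"
    by (intro sum.cong refl) (simp add: ennreal_mult[symmetric] exp_add[symmetric])
  also have "\<dots> = ennreal ((real m + 1) * exp (1 - c))"
    by (simp add: ennreal_mult ennreal_of_nat_eq_real_of_nat add.commute flip: ennreal_1 ennreal_plus)
  also have "ennreal (exp (- c)) + \<dots> = ennreal (exp (- c) + (real m + 1) * exp (1 - c))"
    by (simp add: ennreal_plus)
  also have "\<dots> \<le> ennreal (exp (- c) * (1 + exp 1 * (c + 2)))"
  proof (rule ennreal_leI)
    have "exp (1 - c) = exp 1 * exp (- c)" by (simp flip: exp_add)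
    then have "exp (- c) + (real m + 1) * exp (1 - c) = exp (- c) * (1 + exp 1 * (real m + 1))"
      by (simp add: algebra_simps)
    also have "\<dots> \<le> exp (- c) * (1 + exp 1 * (c + 2))"
      using m by (intro mult_left_mono add_left_mono) auto
    finally show "exp (- c) + (real m + 1) * exp (1 - c) \<le> exp (- c) * (1 + exp 1 * (c + 2))" .
  qed
  finally show ?thesis .
qed

lemma measurable_net_loss[measurable]:
  assumes [measurable]: "f \<in> borel_measurable M" "g \<in> borel_measurable M" "h \<in> borel_measurable M"
  shows "(\<lambda>x. net_loss r (f x) (g x) (h x)) \<in> borel_measurable M"
  unfolding net_loss_altdef by measurable

text \<open>Among the obligors that have defaulted by \<open>s\<close>, those who default at \<open>s\<close> itself have paid the
  most income and hence, for a given loss at default, have the smallest net loss.\<close>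

lemma mgf_net_loss_ge_defaulted:
  fixes D E :: "real measure"
  assumes "prob_space D" "sets D = sets borel" "prob_space E" "sets E = sets borel"
    and "0 \<le> \<alpha>" "0 \<le> r"
  shows "ennreal (measure D {..s}) * (\<integral>\<^sup>+l. ennreal (exp (\<alpha> * (l - r * s))) \<partial>E)
    \<le> (\<integral>\<^sup>+y. ennreal (exp (\<alpha> * net_loss r (fst y) (snd y) s)) \<partial>(D \<Otimes>\<^sub>M E))"
proof -
  interpret D: prob_space D by fact
  interpret E: prob_space E by fact
  note [measurable_cong] = assms(2,4)
  have "ennreal (measure D {..s}) * (\<integral>\<^sup>+l. ennreal (exp (\<alpha> * (l - r * s))) \<partial>E)
      = (\<integral>\<^sup>+v. (\<integral>\<^sup>+l. ennreal (exp (\<alpha> * (l - r * s))) \<partial>E) * indicator {..s} v \<partial>D)"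
    by (subst nn_integral_cmult_indicator) (auto simp: assms(2) D.emeasure_eq_measure mult.commute)
  also have "\<dots> \<le> (\<integral>\<^sup>+v. \<integral>\<^sup>+l. ennreal (exp (\<alpha> * net_loss r v l s)) \<partial>E \<partial>D)"
  proof (rule nn_integral_mono)
    fix v
    show "(\<integral>\<^sup>+l. ennreal (exp (\<alpha> * (l - r * s))) \<partial>E) * indicator {..s} v
        \<le> (\<integral>\<^sup>+l. ennreal (exp (\<alpha> * net_loss r v l s)) \<partial>E)"
    proof (cases "v \<le> s")
      case True
      then have "ennreal (exp (\<alpha> * (l - r * s))) \<le> ennreal (exp (\<alpha> * net_loss r v l s))" for l
        using assms(5,6) by (auto intro!: ennreal_leI mult_left_mono simp: net_loss_altdef)
      then show ?thesis using True by (auto intro!: nn_integral_mono)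
    qed simp
  qed
  also have "\<dots> = (\<integral>\<^sup>+y. ennreal (exp (\<alpha> * net_loss r (fst y) (snd y) s)) \<partial>(D \<Otimes>\<^sub>M E))"
    by (subst E.nn_integral_fst[symmetric]) auto
  finally show ?thesis .
qed

text \<open>The event is that the portfolio is ruined at the default time of obligor \<open>j\<close>. Given
  that this time is \<open>s\<close>, the other obligors are still i.i.d.; Markov's inequality with the exponent
  \<open>\<alpha>\<close> of \<open>H\<close> bounds the conditional probability \<open>b s\<close> by
  \<open>e\<^bsup>-\<alpha> n u\<^esup> (E e\<^bsup>\<alpha> (L - r s)\<^esup>) \<omega>\<^sub>s(\<alpha>)\<^bsup>n-1\<^esup> \<le> e\<^bsup>-n c\<^esup> / F(s)\<close>. The choice of \<open>\<alpha>\<close> may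
  depend on \<open>s\<close> non-measurably: only the resulting bound is integrated.\<close>

lemma prob_ruin_at_default_le:
  fixes D E :: "real measure" and I :: "nat set"
  assumes "prob_space D" "sets D = sets borel" "prob_space E" "sets E = sets borel"
    and "0 \<le> r" "0 \<le> c" and I: "finite I" "j \<notin> I" "n = Suc (card I)" and B: "B \<in> sets borel"
    and H: "\<And>s. s \<in> B \<Longrightarrow> 0 < measure D {..s} \<Longrightarrow> \<exists>\<alpha>\<ge>0.
       (\<integral>\<^sup>+y. ennreal (exp (\<alpha> * net_loss r (fst y) (snd y) s)) \<partial>(D \<Otimes>\<^sub>M E)) \<le> ennreal (exp (\<alpha> * u - c))"
  defines "Q \<equiv> PiM (insert j I) (\<lambda>_. D \<Otimes>\<^sub>M E)"
  shows "emeasure Q {z \<in> space Q. fst (z j) \<in> B \<and>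
       real n * u \<le> (\<Sum>i\<in>insert j I. net_loss r (fst (z i)) (snd (z i)) (fst (z j)))}
     \<le> ennreal (exp (- (real n * c)) * (1 + exp 1 * (real n * c + 2)))"
    (is "emeasure Q ?A \<le> _")
proof -
  interpret D: prob_space D by fact
  interpret E: prob_space E by fact
  note [measurable_cong] = assms(2,4)
  note [measurable] = B
  let ?P = "D \<Otimes>\<^sub>M E"
  interpret P: pair_prob_space D E ..
  interpret prod: product_sigma_finite "\<lambda>_::nat. ?P"
    by standard
  interpret PI: prob_space "PiM I (\<lambda>_. ?P)"
    by (intro prob_space_PiM P.prob_space_axioms)
  have A[measurable]: "?A \<in> sets Q" unfolding Q_def by measurable
  define g :: "real \<Rightarrow> real \<Rightarrow> (nat \<Rightarrow> real \<times> real) \<Rightarrow> real" where "g s l z = indicator B s *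
      indicator {x. 0 \<le> x} ((l - r * s) + (\<Sum>i\<in>I. net_loss r (fst (z i)) (snd (z i)) s) - real n * u)"
    for s l z
  define b where "b s = (\<integral>\<^sup>+l. \<integral>\<^sup>+z. ennreal (g s l z) \<partial>PiM I (\<lambda>_. ?P) \<partial>E)" for s
  have [measurable]: "{x::real. 0 \<le> x} \<in> sets borel" by measurable
  have g1: "g s l z \<le> 1" for s l z by (auto simp: g_def indicator_def)
  have "emeasure Q ?A = (\<integral>\<^sup>+z. indicator ?A z \<partial>Q)" by simp
  also have "\<dots> = (\<integral>\<^sup>+y. (\<integral>\<^sup>+z. indicator ?A (z(j := y)) \<partial>PiM I (\<lambda>_. ?P)) \<partial>?P)"
    unfolding Q_def
    by (rule prod.product_nn_integral_insert_rev[OF I(1,2)]) (use A in \<open>simp add: Q_def\<close>)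
  also have "\<dots> \<le> (\<integral>\<^sup>+y. (\<integral>\<^sup>+z. ennreal (g (fst y) (snd y) z) \<partial>PiM I (\<lambda>_. ?P)) \<partial>?P)"
  proof (intro nn_integral_mono)
    fix y z
    have "(\<Sum>i\<in>I. net_loss r (fst ((z(j := y)) i)) (snd ((z(j := y)) i)) (fst y))
        = (\<Sum>i\<in>I. net_loss r (fst (z i)) (snd (z i)) (fst y))"
      using I(2) by (intro sum.cong) auto
    then show "indicator ?A (z(j := y)) \<le> ennreal (g (fst y) (snd y) z)"
      using I(1,2) by (auto simp: g_def indicator_def net_loss_altdef[of r "fst y" "snd y" "fst y"])
  qed
  also have "\<dots> = (\<integral>\<^sup>+s. b s \<partial>D)"
    unfolding b_def by (subst E.nn_integral_fst[symmetric]) (simp_all add: g_def)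
  also have "\<dots> \<le> ennreal (exp (- (real n * c)) * (1 + exp 1 * (real n * c + 2)))"
  proof (rule nn_integral_truncated_inverse_cdf[OF assms(1,2)])
    show "0 \<le> real n * c" using \<open>0 \<le> c\<close> by simp
    show "b s \<le> 1" for s
    proof -
      have "b s \<le> (\<integral>\<^sup>+l. \<integral>\<^sup>+z. 1 \<partial>PiM I (\<lambda>_. ?P) \<partial>E)"
        unfolding b_def using g1 by (intro nn_integral_mono) (simp flip: ennreal_1)
      then show ?thesis by (simp add: PI.emeasure_space_1 E.emeasure_space_1)
    qed
    show "ennreal (measure D {..s}) * b s \<le> ennreal (exp (- (real n * c)))" for s
    proof (cases "s \<in> B \<and> 0 < measure D {..s}")
      case False
      then have "measure D {..s} = 0 \<or> b s = 0"
        by (auto simp: b_def g_def not_less measure_le_0_iff)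
      then show ?thesis by auto
    next
      case True
      then obtain \<alpha> where \<alpha>: "\<alpha> \<ge> 0" and
        le: "(\<integral>\<^sup>+y. ennreal (exp (\<alpha> * net_loss r (fst y) (snd y) s)) \<partial>?P) \<le> ennreal (exp (\<alpha> * u - c))"
        (is "?\<omega> \<le> _") using H by blast
      define k where "k = card I"
      have inner: "(\<integral>\<^sup>+z. ennreal (g s l z) \<partial>PiM I (\<lambda>_. ?P))
          \<le> ennreal (exp (- (\<alpha> * (real n * u)))) * ennreal (exp (\<alpha> * (l - r * s))) * ?\<omega> ^ k" for l
      proof -
        have "(\<integral>\<^sup>+z. ennreal (g s l z) \<partial>PiM I (\<lambda>_. ?P)) \<le>
            (\<integral>\<^sup>+z. ennreal (exp (- (\<alpha> * (real n * u)))) * ennreal (exp (\<alpha> * (l - r * s)))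
               * (\<Prod>i\<in>I. ennreal (exp (\<alpha> * net_loss r (fst (z i)) (snd (z i)) s))) \<partial>PiM I (\<lambda>_. ?P))"
        proof (rule nn_integral_mono)
          fix z
          let ?S = "(l - r * s) + (\<Sum>i\<in>I. net_loss r (fst (z i)) (snd (z i)) s) - real n * u"
          have "g s l z \<le> exp (\<alpha> * ?S)"
            using \<alpha> by (auto simp: g_def indicator_def)
          also have "\<dots> = exp (- (\<alpha> * (real n * u))) * exp (\<alpha> * (l - r * s))
              * (\<Prod>i\<in>I. exp (\<alpha> * net_loss r (fst (z i)) (snd (z i)) s))"
            unfolding exp_sum[OF I(1), symmetric] exp_add[symmetric] sum_distrib_left[symmetric]
            by (simp add: algebra_simps)
          finally show "ennreal (g s l z) \<le> ennreal (exp (- (\<alpha> * (real n * u)))) * ennreal (exp (\<alpha> * (l - r * s)))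
               * (\<Prod>i\<in>I. ennreal (exp (\<alpha> * net_loss r (fst (z i)) (snd (z i)) s)))"
            by (simp add: ennreal_mult[symmetric] prod_ennreal prod_nonneg ennreal_leI)
        qed
        also have "\<dots> = ennreal (exp (- (\<alpha> * (real n * u)))) * ennreal (exp (\<alpha> * (l - r * s))) * ?\<omega> ^ k"
        proof -
          have "(\<integral>\<^sup>+z. (\<Prod>i\<in>I. ennreal (exp (\<alpha> * net_loss r (fst (z i)) (snd (z i)) s))) \<partial>PiM I (\<lambda>_. ?P))
              = (\<Prod>i\<in>I. ?\<omega>)"
            by (rule prod.product_nn_integral_prod[OF I(1),
                  of "\<lambda>_ y. ennreal (exp (\<alpha> * net_loss r (fst y) (snd y) s))"]) measurable
          then show ?thesis by (subst nn_integral_cmult) (simp_all add: k_def)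
        qed
        finally show ?thesis .
      qed
      have "b s \<le> (\<integral>\<^sup>+l. ennreal (exp (- (\<alpha> * (real n * u)))) * ennreal (exp (\<alpha> * (l - r * s))) * ?\<omega> ^ k \<partial>E)"
        unfolding b_def by (intro nn_integral_mono inner)
      also have "\<dots> = ennreal (exp (- (\<alpha> * (real n * u)))) * (\<integral>\<^sup>+l. ennreal (exp (\<alpha> * (l - r * s))) \<partial>E) * ?\<omega> ^ k"
        by (subst nn_integral_multc, simp, subst nn_integral_cmult) auto
      finally have "ennreal (measure D {..s}) * b s \<le> ennreal (measure D {..s}) *
          (ennreal (exp (- (\<alpha> * (real n * u)))) * (\<integral>\<^sup>+l. ennreal (exp (\<alpha> * (l - r * s))) \<partial>E) * ?\<omega> ^ k)"
        by (intro mult_left_mono) auto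
      also have "\<dots> = ennreal (exp (- (\<alpha> * (real n * u)))) *
          ((ennreal (measure D {..s}) * (\<integral>\<^sup>+l. ennreal (exp (\<alpha> * (l - r * s))) \<partial>E)) * ?\<omega> ^ k)"
        by (simp add: ac_simps)
      also have "\<dots> \<le> ennreal (exp (- (\<alpha> * (real n * u)))) * (?\<omega> * ?\<omega> ^ k)"
        using mgf_net_loss_ge_defaulted[OF assms(1-4) \<alpha> \<open>0 \<le> r\<close>, of s]
        by (intro mult_left_mono mult_right_mono) auto
      also have "\<dots> \<le> ennreal (exp (- (\<alpha> * (real n * u)))) * ennreal (exp (\<alpha> * u - c)) ^ n"
      proof (intro mult_left_mono)
        have "?\<omega> * ?\<omega> ^ k = ?\<omega> ^ n" by (simp add: I(3) k_def)
        then show "?\<omega> * ?\<omega> ^ k \<le> ennreal (exp (\<alpha> * u - c)) ^ n"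
          using power_mono[OF le, of n] by simp
      qed simp
      also have "\<dots> = ennreal (exp (- (\<alpha> * (real n * u))) * exp (real n * (\<alpha> * u - c)))"
        by (simp add: ennreal_power exp_of_nat_mult ennreal_mult)
      also have "\<dots> = ennreal (exp (- (real n * c)))"
        unfolding exp_add[symmetric] by (simp add: algebra_simps)
      finally show ?thesis .
    qed
  qed
  finally show ?thesis .
qed

section \<open>Logarithmic asymptotics\<close>

lemma le_exp_if_less_minus_ln_ext:
  assumes "ereal c < ereal x - ln_ext w"
  shows "w \<le> ennreal (exp (x - c))"
proof (cases w)
  case (real v)
  show ?thesis
  proof (cases "v = 0")
    case False
    then have "c < x - ln v" using assms real by (simp add: ln_ext_def)
    then have "exp (ln v) \<le> exp (x - c)" by simp
    then show ?thesis using real False by (simp add: ennreal_leI)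
  qed (use real in simp)
qed (use assms in \<open>simp add: ln_ext_def\<close>)

lemma exp_le_if_minus_ln_ext_le:
  assumes "ereal x - ln_ext w \<le> ereal c"
  shows "ennreal (exp (x - c)) \<le> w"
proof (cases w)
  case (real v)
  have "v \<noteq> 0" using assms real by (auto simp: ln_ext_def)
  then have "x - ln v \<le> c" using assms real by (simp add: ln_ext_def)
  then have "exp (x - c) \<le> exp (ln v)" by simp
  then show ?thesis using real \<open>v \<noteq> 0\<close> by (simp add: ennreal_leI)
qed simp

lemma ln_ext_root_ge:
  assumes "exp a ^ n \<le> q" "n > 0"
  shows "ereal a \<le> ereal (1 / real n) * ln_ext (ennreal q)"
proof -
  have q: "0 < q" using assms(1) less_le_trans zero_less_power[OF exp_gt_zero] by blast
  have "exp (real n * a) \<le> q" using assms(1) by (simp add: exp_of_nat_mult)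
  then have "real n * a \<le> ln q" using q by (metis ln_exp ln_le_cancel_iff exp_gt_zero)
  then have "a \<le> 1 / real n * ln q" using assms(2) by (simp add: field_simps)
  then show ?thesis using q by (simp add: ln_ext_def)
qed

lemma ln_ext_root_le:
  assumes "q \<le> exp (real n * a)" "n > 0"
  shows "ereal (1 / real n) * ln_ext (ennreal q) \<le> ereal a"
proof (cases "q \<le> 0")
  case True
  then show ?thesis using assms(2) by (simp add: ln_ext_def ennreal_neg)
next
  case False
  then have "ln q \<le> real n * a" using assms(1) by (metis ln_exp ln_le_cancel_iff exp_gt_zero not_le)
  then have "1 / real n * ln q \<le> a" using assms(2) by (simp add: field_simps)
  then show ?thesis using False by (simp add: ln_ext_def)
qed

text \<open>The polynomial prefactor of the upper bound is absorbed into the exponential rate.\<close>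

lemma eventually_prefactor_le_exp:
  fixes c a b :: real
  assumes "0 < c" "a < b"
  shows "\<forall>\<^sub>F n in sequentially.
    real n * (exp (real n * a) * (1 + exp 1 * (real n * c + 2))) \<le> exp (real n * b)"
proof -
  define d where "d = b - a"
  have "d > 0" using assms by (simp add: d_def)
  then have "\<forall>\<^sub>F n in sequentially. real n * (1 + exp 1 * (real n * c + 2)) \<le> exp (real n * d)"
    using \<open>0 < c\<close> by real_asymp
  then show ?thesis
  proof eventually_elim
    case (elim n)
    have "real n * (exp (real n * a) * (1 + exp 1 * (real n * c + 2)))
        = exp (real n * a) * (real n * (1 + exp 1 * (real n * c + 2)))" by simp
    also have "\<dots> \<le> exp (real n * a) * exp (real n * d)"
      using elim by (intro mult_left_mono) auto
    also have "\<dots> = exp (real n * b)"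
      unfolding exp_add[symmetric] d_def by (simp add: algebra_simps)
    finally show ?case .
  qed
qed

section \<open>Ruin happens at a default\<close>

text \<open>Moving back from \<open>s\<close> to the last default (or to \<open>0\<close>) keeps the set of defaulted obligors and
  only reduces the income received.\<close>

lemma sum_net_loss_le_at_last_default:
  fixes \<tau> l :: "'i \<Rightarrow> real"
  assumes I: "finite I" and "0 \<le> r" "0 \<le> s"
  obtains v where "v \<in> insert 0 (\<tau> ` {i\<in>I. 0 \<le> \<tau> i})" "v \<le> s"
    "(\<Sum>i\<in>I. net_loss r (\<tau> i) (l i) s) \<le> (\<Sum>i\<in>I. net_loss r (\<tau> i) (l i) v)"
proof -
  let ?C = "insert 0 (\<tau> ` {i\<in>I. 0 \<le> \<tau> i \<and> \<tau> i \<le> s})"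
  define v where "v = Max ?C"
  have v: "v \<in> ?C" unfolding v_def using I by (intro Max_in) auto
  have ge: "w \<le> v" if "w \<in> ?C" for w
    unfolding v_def using I that by (intro Max_ge) auto
  have "net_loss r (\<tau> i) (l i) s \<le> net_loss r (\<tau> i) (l i) v" if "i \<in> I" for i
  proof -
    have "\<tau> i \<le> s \<longleftrightarrow> \<tau> i \<le> v"
      using ge[of "\<tau> i"] ge[of 0] v that \<open>0 \<le> s\<close> by (cases "0 \<le> \<tau> i") auto
    moreover have "r * min (\<tau> i) v \<le> r * min (\<tau> i) s"
      using v \<open>0 \<le> s\<close> \<open>0 \<le> r\<close> by (intro mult_left_mono) auto
    ultimately show ?thesis by (simp add: net_loss_altdef)
  qed
  then have "(\<Sum>i\<in>I. net_loss r (\<tau> i) (l i) s) \<le> (\<Sum>i\<in>I. net_loss r (\<tau> i) (l i) v)"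
    by (rule sum_mono)
  then show ?thesis using that v \<open>0 \<le> s\<close> by auto
qed

section \<open>The portfolio model\<close>

locale iid_obligors = prob_space M for M :: "'a measure" +
  fixes u r :: real and T L :: "'a \<Rightarrow> real" and Ti Li :: "nat \<Rightarrow> 'a \<Rightarrow> real"
  assumes u: "u > 0" and r: "r > 0"
    and T_meas[measurable]: "T \<in> borel_measurable M" and T_nonneg: "AE x in M. T x \<ge> 0"
    and L_meas[measurable]: "L \<in> borel_measurable M" and L_nonneg: "AE x in M. L x \<ge> 0"
    and indep_TL: "indep_var borel T borel L"
    and indep_obligors: "indep_vars (\<lambda>_. borel \<Otimes>\<^sub>M borel) (\<lambda>i x. (Ti i x, Li i x)) {1..}"
    and law_obligors: "\<And>i. i \<ge> 1 \<Longrightarrow>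
           distr M (borel \<Otimes>\<^sub>M borel) (\<lambda>x. (Ti i x, Li i x))
             = distr M (borel \<Otimes>\<^sub>M borel) (\<lambda>x. (T x, L x))"
    and rarity: "(SUP s\<in>{0::real..}.
             ereal (measure M {x \<in> space M. T x \<le> s}) * enn2ereal (\<integral>\<^sup>+ x. ennreal (L x) \<partial>M)
               - ereal (r * (\<integral>x. min (T x) s \<partial>M))) < ereal u"
begin

abbreviation ruin_event :: "ereal \<Rightarrow> nat \<Rightarrow> 'a set" where
  "ruin_event t n \<equiv> {x \<in> space M. \<exists>s::real. 0 \<le> s \<and> ereal s \<le> t \<and>
     (\<Sum>i=1..n. net_loss r (Ti i x) (Li i x) s) \<ge> real n * u}"

abbreviation pair_law :: "(real \<times> real) measure" where
  "pair_law \<equiv> distr M borel T \<Otimes>\<^sub>M distr M borel L"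

lemma pair_law_eq: "pair_law = distr M (borel \<Otimes>\<^sub>M borel) (\<lambda>x. (T x, L x))"
  using indep_TL by (simp add: indep_var_distribution_eq)

lemma obligor_measurable:
  assumes "i \<ge> 1"
  shows "(\<lambda>x. (Ti i x, Li i x)) \<in> measurable M (borel \<Otimes>\<^sub>M borel)"
    "Ti i \<in> borel_measurable M" "Li i \<in> borel_measurable M"
proof -
  show p: "(\<lambda>x. (Ti i x, Li i x)) \<in> measurable M (borel \<Otimes>\<^sub>M borel)"
    using indep_obligors assms by (auto simp: indep_vars_def)
  show "Ti i \<in> borel_measurable M" using measurable_compose[OF p measurable_fst] by simp
  show "Li i \<in> borel_measurable M" using measurable_compose[OF p measurable_snd] by simp
qed

lemma obligor_law: "i \<ge> 1 \<Longrightarrow> distr M (borel \<Otimes>\<^sub>M borel) (\<lambda>x. (Ti i x, Li i x)) = pair_law"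
  by (simp add: law_obligors pair_law_eq)

lemma mgf_eq_pair_law:
  "mgf M r T L s \<alpha> = (\<integral>\<^sup>+y. ennreal (exp (\<alpha> * net_loss r (fst y) (snd y) s)) \<partial>pair_law)"
  unfolding pair_law_eq mgf_def by (subst nn_integral_distr) auto

lemma mgf_obligor: "i \<ge> 1 \<Longrightarrow> mgf M r (Ti i) (Li i) s \<alpha> = mgf M r T L s \<alpha>"
proof -
  assume i: "i \<ge> 1"
  have "mgf M r (Ti i) (Li i) s \<alpha> = (\<integral>\<^sup>+y. ennreal (exp (\<alpha> * net_loss r (fst y) (snd y) s))
      \<partial>distr M (borel \<Otimes>\<^sub>M borel) (\<lambda>x. (Ti i x, Li i x)))"
    unfolding mgf_def by (subst nn_integral_distr[OF obligor_measurable(1)[OF i]]) simp_all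
  then show ?thesis by (simp only: obligor_law[OF i] mgf_eq_pair_law)
qed

lemma omega_obligor: "i \<ge> 1 \<Longrightarrow> omega M r (Ti i) (Li i) s \<alpha> = omega M r T L s \<alpha>"
  unfolding omega_def by (simp add: mgf_obligor)

lemma rate_obligor: "i \<ge> 1 \<Longrightarrow> rate M u r (Ti i) (Li i) s = rate M u r T L s"
  unfolding rate_def rate_arg_def by (simp add: omega_obligor)

text \<open>Negative exponents never push \<open>\<alpha> u - log \<omega>\<^sub>s(\<alpha>)\<close> above \<open>0\<close>: by rarity \<open>E W(s) < u\<close>, and
  \<open>E e\<^bsup>\<alpha> (W(s) - u)\<^esup> \<ge> 1 + \<alpha> (E W(s) - u) \<ge> 1\<close>. A positive default probability by time \<open>s\<close> enters
  because rarity then forces \<open>E L\<close> to be finite.\<close>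

lemma mgf_ge_exp_of_nonpos:
  assumes "\<alpha> \<le> 0" "0 \<le> s" "0 < measure M {x \<in> space M. T x \<le> s}"
  shows "ennreal (exp (\<alpha> * u)) \<le> mgf M r T L s \<alpha>"
proof -
  define p where "p = measure M {x \<in> space M. T x \<le> s}"
  define EL where "EL = (\<integral>\<^sup>+ x. ennreal (L x) \<partial>M)"
  have "ereal p * enn2ereal EL - ereal (r * (\<integral>x. min (T x) s \<partial>M))
      \<le> (SUP s\<in>{0::real..}. ereal (measure M {x \<in> space M. T x \<le> s}) * enn2ereal (\<integral>\<^sup>+ x. ennreal (L x) \<partial>M)
               - ereal (r * (\<integral>x. min (T x) s \<partial>M)))"
    unfolding p_def EL_def using \<open>0 \<le> s\<close> by (intro SUP_upper) auto
  then have rar: "ereal p * enn2ereal EL - ereal (r * (\<integral>x. min (T x) s \<partial>M)) < ereal u"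
    using rarity by (rule order.strict_trans1)
  have "p > 0" using assms(3) by (simp add: p_def)
  have "EL \<noteq> \<infinity>"
  proof
    assume "EL = \<infinity>"
    then show False using rar \<open>p > 0\<close> by simp
  qed
  then have iL: "integrable M L"
    using L_nonneg unfolding EL_def by (intro integrableI_nonneg) (auto simp: top.not_eq_extremum)
  have EL: "EL = ennreal (\<integral>x. L x \<partial>M)"
    unfolding EL_def using iL L_nonneg by (rule nn_integral_eq_integral)
  have "0 \<le> (\<integral>x. L x \<partial>M)" using L_nonneg by (rule integral_nonneg_AE)
  then have rar': "p * (\<integral>x. L x \<partial>M) - r * (\<integral>x. min (T x) s \<partial>M) < u"
    using rar by (simp add: EL)
  have i1: "integrable M (\<lambda>x. indicator {..s} (T x) :: real)"
    by (intro integrable_const_bound[where B=1]) (auto simp: indicator_def)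
  have E1: "(\<integral>x. indicator {..s} (T x) \<partial>M) = p"
  proof -
    have ind: "(\<lambda>x. indicator {..s} (T x) :: real) = indicator (T -` {..s})"
      by (rule ext) (simp only: indicator_vimage)
    have sp: "T -` {..s} \<inter> space M = {x \<in> space M. T x \<le> s}" by blast
    show ?thesis
      unfolding ind Bochner_Integration.integral_indicator sp p_def ..
  qed
  have "indep_var borel ((indicator {..s} :: real \<Rightarrow> real) \<circ> T) borel ((\<lambda>l. l) \<circ> L)"
    by (rule indep_var_compose[OF indep_TL]) measurable
  then have "indep_var borel (\<lambda>x. indicator {..s} (T x) :: real) borel L"
    by (simp only: comp_def)
  note il = indep_var_integrable[OF this i1 iL] indep_var_lebesgue_integral[OF this i1 iL]
  have im: "integrable M (\<lambda>x. min (T x) s)"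
  proof (rule integrable_const_bound[where B=s])
    show "AE x in M. norm (min (T x) s) \<le> s"
      using T_nonneg by eventually_elim (use \<open>0 \<le> s\<close> in auto)
  qed measurable
  define W where "W x = net_loss r (T x) (L x) s" for x
  have imr: "integrable M (\<lambda>x. r * min (T x) s)" using im by (rule integrable_mult_right)
  have iW: "integrable M W" unfolding W_def net_loss_def
    by (rule Bochner_Integration.integrable_diff[OF il(1) imr])
  have EW: "(\<integral>x. W x \<partial>M) = p * (\<integral>x. L x \<partial>M) - r * (\<integral>x. min (T x) s \<partial>M)"
    unfolding W_def net_loss_def Bochner_Integration.integral_diff[OF il(1) imr] il(2) E1 by simp
  have mW[measurable]: "W \<in> borel_measurable M" unfolding W_def by measurable
  have "AE x in M. - (r * s) \<le> W x"
    using L_nonneg T_nonneg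
  proof eventually_elim
    case (elim x)
    have "r * min (T x) s \<le> r * s" using r by (intro mult_left_mono) auto
    moreover have "0 \<le> (if T x \<le> s then L x else 0)" using elim by simp
    ultimately show ?case unfolding W_def net_loss_altdef by linarith
  qed
  then have "AE x in M. norm (exp (\<alpha> * W x)) \<le> exp (\<alpha> * (- (r * s)))"
  proof eventually_elim
    case (elim x)
    then show ?case using mult_left_mono_neg[OF elim \<open>\<alpha> \<le> 0\<close>] by simp
  qed
  then have ie: "integrable M (\<lambda>x. exp (\<alpha> * W x))"
    by (rule integrable_const_bound) measurable
  have "exp (\<alpha> * u) * 1 \<le> exp (\<alpha> * u) * (1 + \<alpha> * ((\<integral>x. W x \<partial>M) - u))"
    using rar' \<open>\<alpha> \<le> 0\<close> by (intro mult_left_mono) (auto simp: EW mult_nonpos_nonpos)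
  also have "\<dots> = (\<integral>x. exp (\<alpha> * u) * (1 + \<alpha> * (W x - u)) \<partial>M)"
  proof -
    have "(\<integral>x. W x - u \<partial>M) = (\<integral>x. W x \<partial>M) - u"
      using iW by (simp add: prob_space)
    moreover have "integrable M (\<lambda>x. \<alpha> * (W x - u))" using iW by simp
    ultimately show ?thesis by (simp add: prob_space)
  qed
  also have "\<dots> \<le> (\<integral>x. exp (\<alpha> * W x) \<partial>M)"
  proof (rule integral_mono)
    fix x
    have "exp (\<alpha> * u) * (1 + \<alpha> * (W x - u)) \<le> exp (\<alpha> * u) * exp (\<alpha> * (W x - u))"
      by (intro mult_left_mono exp_ge_add_one_self) auto
    also have "\<dots> = exp (\<alpha> * W x)" unfolding exp_add[symmetric] by (simp add: algebra_simps)
    finally show "exp (\<alpha> * u) * (1 + \<alpha> * (W x - u)) \<le> exp (\<alpha> * W x)" .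
  qed (use iW ie in auto)
  finally have "ennreal (exp (\<alpha> * u)) \<le> ennreal (\<integral>x. exp (\<alpha> * W x) \<partial>M)" by (simp add: ennreal_leI)
  also have "\<dots> = mgf M r T L s \<alpha>"
    unfolding mgf_def W_def[symmetric] using ie by (intro nn_integral_eq_integral[symmetric]) auto
  finally show ?thesis .
qed

text \<open>The integrands converge pointwise, but a dominating function may be missing when \<open>e\<^bsup>\<alpha> L\<^esup>\<close> is not
  integrable. Fatou's lemma gives one inequality; for the other, the obligors that have not defaulted
  by \<open>v\<close> contribute at most \<open>e\<^bsup>-\<alpha> r v\<^esup>\<close>.\<close>

lemma omega_infinity:
  assumes "\<alpha> \<ge> 0"
  shows "omega M r T L \<infinity> \<alpha> = (\<integral>\<^sup>+x. ennreal (exp (\<alpha> * (L x - r * T x))) \<partial>M)" (is "_ = ?J")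
proof -
  have "((\<lambda>v. mgf M r T L v \<alpha>) \<longlongrightarrow> ?J) at_top"
  proof (cases "\<alpha> = 0")
    case True
    then show ?thesis by (simp add: mgf_def emeasure_space_1)
  next
    case False
    then have \<alpha>: "\<alpha> > 0" using assms by simp
    show ?thesis
    proof (rule tendsto_at_topI_sequentially)
      fix X :: "nat \<Rightarrow> real" assume X: "filterlim X at_top sequentially"
      have low: "?J \<le> liminf (\<lambda>n. mgf M r T L (X n) \<alpha>)"
      proof -
        have "?J = (\<integral>\<^sup>+x. liminf (\<lambda>n. ennreal (exp (\<alpha> * net_loss r (T x) (L x) (X n)))) \<partial>M)"
        proof (rule nn_integral_cong)
          fix x
          have "\<forall>\<^sub>F n in sequentially. T x \<le> X n" using X by (simp add: filterlim_at_top)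
          then have "\<forall>\<^sub>F n in sequentially. ennreal (exp (\<alpha> * net_loss r (T x) (L x) (X n)))
              = ennreal (exp (\<alpha> * (L x - r * T x)))"
            by eventually_elim (simp add: net_loss_altdef)
          then have "(\<lambda>n. ennreal (exp (\<alpha> * net_loss r (T x) (L x) (X n))))
              \<longlonglongrightarrow> ennreal (exp (\<alpha> * (L x - r * T x)))" by (rule tendsto_eventually)
          then show "ennreal (exp (\<alpha> * (L x - r * T x)))
              = liminf (\<lambda>n. ennreal (exp (\<alpha> * net_loss r (T x) (L x) (X n))))"
            by (intro lim_imp_Liminf[symmetric]) auto
        qed
        also have "\<dots> \<le> liminf (\<lambda>n. mgf M r T L (X n) \<alpha>)"
          unfolding mgf_def by (intro nn_integral_liminf) measurable
        finally show ?thesis .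
      qed
      have up: "limsup (\<lambda>n. mgf M r T L (X n) \<alpha>) \<le> ?J"
      proof -
        have le: "mgf M r T L v \<alpha> \<le> ?J + ennreal (exp (- (\<alpha> * r * v)))" for v
        proof -
          have "mgf M r T L v \<alpha> \<le> (\<integral>\<^sup>+x. ennreal (exp (\<alpha> * (L x - r * T x))) + ennreal (exp (- (\<alpha> * r * v))) \<partial>M)"
            unfolding mgf_def
            by (intro nn_integral_mono)
               (auto simp: net_loss_altdef add_increasing add_increasing2 mult.assoc)
          also have "\<dots> = ?J + ennreal (exp (- (\<alpha> * r * v)))"
            by (subst nn_integral_add) (auto simp: emeasure_space_1)
          finally show ?thesis .
        qed
        have "(\<lambda>n. exp (- (\<alpha> * r * X n))) \<longlonglongrightarrow> 0"
        proof (rule filterlim_compose[OF exp_at_bot])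
          have "filterlim (\<lambda>n. \<alpha> * r * X n) at_top sequentially"
            using \<alpha> r X by (intro filterlim_tendsto_pos_mult_at_top[OF tendsto_const]) auto
          then show "filterlim (\<lambda>n. - (\<alpha> * r * X n)) at_bot sequentially"
            by (simp add: filterlim_uminus_at_bot)
        qed
        then have "(\<lambda>n. ?J + ennreal (exp (- (\<alpha> * r * X n)))) \<longlonglongrightarrow> ?J + ennreal 0"
          by (intro tendsto_add tendsto_const tendsto_ennrealI)
        then have "limsup (\<lambda>n. ?J + ennreal (exp (- (\<alpha> * r * X n)))) = ?J"
          by (intro lim_imp_Limsup) auto
        moreover have "limsup (\<lambda>n. mgf M r T L (X n) \<alpha>) \<le> limsup (\<lambda>n. ?J + ennreal (exp (- (\<alpha> * r * X n))))"
          by (intro Limsup_mono always_eventually allI le)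
        ultimately show ?thesis by simp
      qed
      have "liminf (\<lambda>n. mgf M r T L (X n) \<alpha>) \<le> limsup (\<lambda>n. mgf M r T L (X n) \<alpha>)"
        by (rule Liminf_le_Limsup) simp
      then show "(\<lambda>n. mgf M r T L (X n) \<alpha>) \<longlonglongrightarrow> ?J"
        using low up by (intro Liminf_eq_Limsup antisym) auto
    qed
  qed
  then have "Lim at_top (\<lambda>v. mgf M r T L v \<alpha>) = ?J" by (intro tendsto_Lim) auto
  then show ?thesis by (simp add: omega_def)
qed

text \<open>This writes the event as a finite union and so makes its measurability visible.\<close>

lemma ruin_event_eq:
  assumes "0 \<le> t"
  shows "ruin_event t n = {x \<in> space M. real n * u \<le> (\<Sum>i=1..n. net_loss r (Ti i x) (Li i x) 0)} \<union>
    (\<Union>j\<in>{1..n}. {x \<in> space M. 0 \<le> Ti j x \<and> ereal (Ti j x) \<le> t \<and>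
        real n * u \<le> (\<Sum>i=1..n. net_loss r (Ti i x) (Li i x) (Ti j x))})"
    (is "_ = ?R")
proof (intro set_eqI iffI)
  fix x assume "x \<in> ruin_event t n"
  then obtain s where x: "x \<in> space M" and s: "0 \<le> s" "ereal s \<le> t"
    "real n * u \<le> (\<Sum>i=1..n. net_loss r (Ti i x) (Li i x) s)" by auto
  obtain v where v: "v \<in> insert 0 ((\<lambda>i. Ti i x) ` {i\<in>{1..n}. 0 \<le> Ti i x})" "v \<le> s"
    "(\<Sum>i=1..n. net_loss r (Ti i x) (Li i x) s) \<le> (\<Sum>i=1..n. net_loss r (Ti i x) (Li i x) v)"
    using sum_net_loss_le_at_last_default[of "{1..n}" r s "\<lambda>i. Ti i x" "\<lambda>i. Li i x"] r s(1) by auto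
  have nv: "real n * u \<le> (\<Sum>i=1..n. net_loss r (Ti i x) (Li i x) v)" using s(3) v(3) by simp
  have vt: "ereal v \<le> t" using v(2) s(2) by (meson ereal_less_eq(3) order_trans)
  from v(1) consider "v = 0" | j where "j \<in> {1..n}" "0 \<le> Ti j x" "v = Ti j x" by blast
  then show "x \<in> ?R"
  proof cases
    case 1
    then show ?thesis using nv x by blast
  next
    case 2
    then show ?thesis using nv vt x by blast
  qed
next
  fix x assume "x \<in> ?R"
  then show "x \<in> ruin_event t n"
  proof
    assume x: "x \<in> {x \<in> space M. real n * u \<le> (\<Sum>i=1..n. net_loss r (Ti i x) (Li i x) 0)}"
    have "ereal 0 \<le> t" using assms unfolding zero_ereal_def[symmetric] .
    then show ?thesis using x by blast
  qed blast
qed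

lemma ruin_event_measurable:
  assumes "0 \<le> t"
  shows "ruin_event t n \<in> sets M"
proof -
  note [measurable] = obligor_measurable
  show ?thesis unfolding ruin_event_eq[OF assms]
    by (intro sets.Un sets.finite_UN finite_atLeastAtMost) measurable
qed

lemma AE_obligor_nonneg:
  assumes i: "i \<ge> 1"
  shows "AE x in M. 0 \<le> Ti i x"
proof -
  let ?B = "borel \<Otimes>\<^sub>M borel :: (real \<times> real) measure"
  have S: "{y \<in> space ?B. 0 \<le> fst y} \<in> sets ?B"
    by (rule borel_measurable_le[OF borel_measurable_const measurable_fst])
  have "(\<lambda>x. (T x, L x)) \<in> measurable M ?B" by measurable
  from AE_distr_iff[OF this S] have "AE y in distr M ?B (\<lambda>x. (T x, L x)). 0 \<le> fst y"
    using T_nonneg by (simp only: fst_conv)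
  then have "AE y in distr M ?B (\<lambda>x. (Ti i x, Li i x)). 0 \<le> fst y"
    by (simp only: law_obligors[OF i])
  then show ?thesis
    using AE_distr_iff[OF obligor_measurable(1)[OF i] S] by (simp only: fst_conv)
qed

section \<open>Upper and lower bounds for the ruin probability\<close>

text \<open>The exponent demanded by \<open>prob_ruin_at_default_le\<close> comes from the supremum in the rate, which
  exceeds \<open>c\<close>; summing over the \<open>n\<close> obligors that may trigger ruin gives the factor \<open>n\<close>.\<close>

lemma ruin_prob_le:
  assumes "0 \<le> t" "0 < c" "n > 0"
    and rate: "\<And>s. 0 \<le> s \<Longrightarrow> ereal s \<le> t \<Longrightarrow> ereal c < rate M u r T L (ereal s)"
  shows "ruin_prob M u r Ti Li t n \<le> real n * (exp (real n * (- c)) * (1 + exp 1 * (real n * c + 2)))"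
proof -
  define B where "B = {s::real. 0 \<le> s \<and> ereal s \<le> t}"
  have B: "B \<in> sets borel" unfolding B_def by measurable
  have chernoff: "\<exists>\<alpha>\<ge>0. (\<integral>\<^sup>+y. ennreal (exp (\<alpha> * net_loss r (fst y) (snd y) s)) \<partial>pair_law) \<le> ennreal (exp (\<alpha> * u - c))"
    if s: "s \<in> B" "0 < measure (distr M borel T) {..s}" for s
  proof -
    have Fs: "0 < measure M {x \<in> space M. T x \<le> s}"
    proof -
      have "T -` {..s} \<inter> space M = {x \<in> space M. T x \<le> s}" by auto
      then show ?thesis using s(2) by (simp add: measure_distr)
    qed
    obtain \<alpha> where \<alpha>: "ereal c < rate_arg M u r T L (ereal s) \<alpha>"
      using rate[of s] s(1) unfolding B_def rate_def less_SUP_iff by auto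
    have le: "mgf M r T L s \<alpha> \<le> ennreal (exp (\<alpha> * u - c))"
      using le_exp_if_less_minus_ln_ext[OF \<alpha>[unfolded rate_arg_def]] by (simp add: omega_def)
    have "\<alpha> \<ge> 0"
    proof (rule ccontr)
      assume "\<not> ?thesis"
      then have "ennreal (exp (\<alpha> * u)) \<le> mgf M r T L s \<alpha>"
        using s(1) Fs by (intro mgf_ge_exp_of_nonpos) (auto simp: B_def)
      then have "ennreal (exp (\<alpha> * u)) \<le> ennreal (exp (\<alpha> * u - c))" using le by (rule order_trans)
      then show False using \<open>0 < c\<close> by simp
    qed
    then show ?thesis using le by (auto simp: mgf_eq_pair_law)
  qed
  define V where "V x = (\<lambda>i\<in>{1..n}. (Ti i x, Li i x))" for x
  define Q where "Q = PiM {1..n} (\<lambda>_. pair_law)"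
  have Qsets: "sets Q = sets (PiM {1..n} (\<lambda>_. borel \<Otimes>\<^sub>M borel))"
    unfolding Q_def by (intro sets_PiM_cong refl sets_pair_measure_cong) auto
  have V[measurable]: "V \<in> measurable M (PiM {1..n} (\<lambda>_. borel \<Otimes>\<^sub>M borel))"
    unfolding V_def by (intro measurable_restrict obligor_measurable) auto
  have VQ: "distr M (PiM {1..n} (\<lambda>_. borel \<Otimes>\<^sub>M borel)) V = Q"
  proof -
    have "indep_vars (\<lambda>_. borel \<Otimes>\<^sub>M borel) (\<lambda>i x. (Ti i x, Li i x)) {1..n}"
      by (rule indep_vars_subset[OF indep_obligors]) auto
    then have "distr M (PiM {1..n} (\<lambda>_. borel \<Otimes>\<^sub>M borel)) V
        = PiM {1..n} (\<lambda>i. distr M (borel \<Otimes>\<^sub>M borel) (\<lambda>x. (Ti i x, Li i x)))"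
      unfolding V_def using \<open>n > 0\<close> obligor_measurable(1)
      by (subst (asm) indep_vars_iff_distr_eq_PiM') auto
    also have "\<dots> = Q" unfolding Q_def by (intro PiM_cong refl obligor_law) auto
    finally show ?thesis .
  qed
  define A where "A j = {z \<in> space Q. fst (z j) \<in> B \<and>
       real n * u \<le> (\<Sum>i=1..n. net_loss r (fst (z i)) (snd (z i)) (fst (z j)))}" for j
  let ?b = "exp (- (real n * c)) * (1 + exp 1 * (real n * c + 2))"
  have A_sets: "A j \<in> sets Q" if "j \<in> {1..n}" for j
  proof -
    note [measurable] = B
    have [measurable]: "(\<lambda>z. z i) \<in> measurable Q (borel \<Otimes>\<^sub>M borel)" if "i \<in> {1..n}" for i
      using measurable_component_singleton[OF that, of "\<lambda>_. borel \<Otimes>\<^sub>M borel"]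
      by (simp add: measurable_cong_sets[OF Qsets refl])
    show ?thesis unfolding A_def using that by measurable
  qed
  have A_le: "emeasure Q (A j) \<le> ennreal ?b" if j: "j \<in> {1..n}" for j
  proof -
    have ins: "insert j ({1..n} - {j}) = {1..n}" using j by auto
    have "n = Suc (card ({1..n} - {j}))" using j by simp
    from prob_ruin_at_default_le[where j = j and I = "{1..n} - {j}" and u = u, OF prob_space_distr[OF T_meas] sets_distr prob_space_distr[OF L_meas] sets_distr
        less_imp_le[OF r] less_imp_le[OF \<open>0 < c\<close>] _ _ this B chernoff]
    show ?thesis unfolding A_def Q_def ins by simp
  qed
  have "emeasure M (ruin_event t n) \<le> emeasure M (\<Union>j\<in>{1..n}. V -` A j \<inter> space M)"
  proof (rule emeasure_mono_AE)
    have "AE x in M. \<forall>i\<in>{1..n}. 0 \<le> Ti i x"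
      using AE_obligor_nonneg by (intro AE_finite_allI) auto
    then show "AE x in M. x \<in> ruin_event t n \<longrightarrow> x \<in> (\<Union>j\<in>{1..n}. V -` A j \<inter> space M)"
    proof eventually_elim
      case (elim x)
      show ?case
      proof
        assume "x \<in> ruin_event t n"
        then have x: "x \<in> space M" by simp
        let ?S = "\<lambda>v. \<Sum>i=1..n. net_loss r (Ti i x) (Li i x) v"
        have "\<exists>j\<in>{1..n}. ereal (Ti j x) \<le> t \<and> real n * u \<le> ?S (Ti j x)"
        proof (cases "real n * u \<le> ?S 0")
          case False
          then show ?thesis
            using \<open>x \<in> ruin_event t n\<close> unfolding ruin_event_eq[OF \<open>0 \<le> t\<close>] by blast
        next
          case True
          (* With no default at time 0 the aggregate net loss vanishes there, below n * u. *)
          have "\<exists>j\<in>{1..n}. Ti j x = 0"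
          proof (rule ccontr)
            assume no: "\<not> ?thesis"
            have "net_loss r (Ti i x) (Li i x) 0 = 0" if "i \<in> {1..n}" for i
            proof -
              have "Ti i x > 0" using no elim that by force
              then show ?thesis by (simp add: net_loss_altdef)
            qed
            then have "real n * u \<le> 0" using True by simp
            then show False using u \<open>n > 0\<close> by (simp add: mult_le_0_iff)
          qed
          then obtain j where j: "j \<in> {1..n}" "Ti j x = 0" by blast
          have "ereal (Ti j x) \<le> t" "real n * u \<le> ?S (Ti j x)"
            unfolding j(2) using \<open>0 \<le> t\<close> True by (simp_all flip: zero_ereal_def)
          with j(1) show ?thesis by blast
        qed
        then obtain j where j: "j \<in> {1..n}" "ereal (Ti j x) \<le> t" "real n * u \<le> ?S (Ti j x)"
          by blast
        define v where "v = Ti j x"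
        have "V x \<in> space Q"
          using measurable_space[OF V x] sets_eq_imp_space_eq[OF Qsets] by simp
        moreover have "(\<Sum>i=1..n. net_loss r (fst (V x i)) (snd (V x i)) v) = ?S v"
          by (intro sum.cong) (auto simp: V_def)
        moreover have "fst (V x j) = v" using j by (simp add: V_def v_def)
        moreover have "v \<in> B" using j elim by (auto simp: B_def v_def)
        ultimately have "V x \<in> A j" using j(3) by (simp add: A_def v_def)
        then show "x \<in> (\<Union>j\<in>{1..n}. V -` A j \<inter> space M)" using j x by blast
      qed
    qed
    show "(\<Union>j\<in>{1..n}. V -` A j \<inter> space M) \<in> sets M"
      using A_sets Qsets V by (intro sets.finite_UN measurable_sets[OF V]) auto
  qed
  also have "\<dots> \<le> (\<Sum>j\<in>{1..n}. emeasure M (V -` A j \<inter> space M))"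
    using A_sets Qsets V by (intro emeasure_subadditive_finite) (auto intro!: measurable_sets[OF V])
  also have "\<dots> = (\<Sum>j\<in>{1..n}. emeasure Q (A j))"
  proof (intro sum.cong refl)
    fix j assume "j \<in> {1..n}"
    then have "A j \<in> sets (PiM {1..n} (\<lambda>_. borel \<Otimes>\<^sub>M borel))" using A_sets Qsets by simp
    from emeasure_distr[OF V this] show "emeasure M (V -` A j \<inter> space M) = emeasure Q (A j)"
      by (simp only: VQ)
  qed
  also have "\<dots> \<le> (\<Sum>j\<in>{1..n}. ennreal ?b)" by (intro sum_mono A_le)
  also have "\<dots> = ennreal (real n * ?b)"
    by (subst ennreal_mult') (simp_all add: ennreal_of_nat_eq_real_of_nat)
  finally have "emeasure M (ruin_event t n) \<le> ennreal (real n * ?b)" .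
  then have "measure M (ruin_event t n) \<le> real n * ?b"
    using \<open>0 < c\<close> by (simp add: emeasure_eq_measure ennreal_le_iff)
  then show ?thesis by (simp add: ruin_prob_def)
qed

text \<open>Cramer's bound for the summands \<open>\<phi>(T\<^sub>i, L\<^sub>i) - u\<close>. The function \<open>\<phi>\<close> stands for the net loss at a
  fixed time, or for the net loss \<open>L - r T\<close> at infinity.\<close>

lemma eventually_ruin_prob_ge:
  fixes \<phi> :: "real \<times> real \<Rightarrow> real"
  assumes "0 \<le> t" and \<phi>[measurable]: "\<phi> \<in> borel_measurable (borel \<Otimes>\<^sub>M borel)"
    and sub: "\<And>n x. n > 0 \<Longrightarrow> x \<in> space M \<Longrightarrow> real n * u \<le> (\<Sum>i=1..n. \<phi> (Ti i x, Li i x)) \<Longrightarrow>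
        x \<in> ruin_event t n"
    and mgf: "\<And>\<alpha>. \<alpha> \<ge> 0 \<Longrightarrow> ennreal (exp (\<alpha> * u - c)) \<le> (\<integral>\<^sup>+x. ennreal (exp (\<alpha> * \<phi> (T x, L x))) \<partial>M)"
    and "a < - c"
  shows "\<forall>\<^sub>F n in sequentially. exp a ^ n \<le> ruin_prob M u r Ti Li t n"
proof -
  define N where "N = distr pair_law borel (\<lambda>y. \<phi> y - u)"
  have "indep_vars (\<lambda>_. borel) (\<lambda>i x. \<phi> (Ti i x, Li i x) - u) {1..}"
    using indep_vars_compose2[OF indep_obligors, of "\<lambda>_ y. \<phi> y - u" "\<lambda>_. borel"] by simp
  moreover have "distr M borel (\<lambda>x. \<phi> (Ti i x, Li i x) - u) = N" if i: "i \<ge> 1" for i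
    unfolding N_def obligor_law[OF i, symmetric]
    by (subst distr_distr) (use obligor_measurable(1)[OF i] in \<open>auto simp: comp_def\<close>)
  moreover have "ennreal (exp (- c)) \<le> (\<integral>\<^sup>+y. ennreal (exp (\<alpha> * y)) \<partial>N)" if "\<alpha> \<ge> 0" for \<alpha>
  proof -
    have "ennreal (exp (- c)) = ennreal (exp (- (\<alpha> * u))) * ennreal (exp (\<alpha> * u - c))"
      unfolding ennreal_mult[OF exp_ge_zero exp_ge_zero, symmetric] exp_add[symmetric] by simp
    also have "\<dots> \<le> ennreal (exp (- (\<alpha> * u))) * (\<integral>\<^sup>+x. ennreal (exp (\<alpha> * \<phi> (T x, L x))) \<partial>M)"
      by (intro mult_left_mono mgf that) auto
    also have "\<dots> = (\<integral>\<^sup>+x. ennreal (exp (- (\<alpha> * u))) * ennreal (exp (\<alpha> * \<phi> (T x, L x))) \<partial>M)"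
      by (rule nn_integral_cmult[symmetric]) measurable
    also have "\<dots> = (\<integral>\<^sup>+x. ennreal (exp (\<alpha> * (\<phi> (T x, L x) - u))) \<partial>M)"
      unfolding ennreal_mult[OF exp_ge_zero exp_ge_zero, symmetric] exp_add[symmetric]
      by (simp add: algebra_simps)
    also have "\<dots> = (\<integral>\<^sup>+y. ennreal (exp (\<alpha> * y)) \<partial>N)"
      unfolding N_def pair_law_eq by (subst nn_integral_distr, simp, simp)+ simp
    finally show ?thesis .
  qed
  moreover have "exp a < exp (- c)" using \<open>a < - c\<close> by simp
  ultimately have "\<forall>\<^sub>F n in sequentially. exp a ^ n \<le>
      measure M {x \<in> space M. 0 \<le> (\<Sum>i=1..n. \<phi> (Ti i x, Li i x) - u)}"
    by (intro cramer_lower_bound[OF prob_space_axioms]) auto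
  then show ?thesis
    using eventually_gt_at_top[of 0]
  proof eventually_elim
    case (elim n)
    have "{x \<in> space M. 0 \<le> (\<Sum>i=1..n. \<phi> (Ti i x, Li i x) - u)} \<subseteq> ruin_event t n"
    proof
      fix x assume "x \<in> {x \<in> space M. 0 \<le> (\<Sum>i=1..n. \<phi> (Ti i x, Li i x) - u)}"
      then show "x \<in> ruin_event t n" using elim(2) by (intro sub) (auto simp: sum_subtractf)
    qed
    then have "measure M {x \<in> space M. 0 \<le> (\<Sum>i=1..n. \<phi> (Ti i x, Li i x) - u)} \<le> measure M (ruin_event t n)"
      by (intro finite_measure_mono ruin_event_measurable[OF \<open>0 \<le> t\<close>])
    then show ?case using elim(1) by (simp add: ruin_prob_def)
  qed
qed

lemma eventually_ruin_prob_ge_rate: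
  assumes "0 \<le> t" "s \<in> {0..t}" and rate: "rate M u r T L s \<le> ereal c" and "a < - c"
  shows "\<forall>\<^sub>F n in sequentially. exp a ^ n \<le> ruin_prob M u r Ti Li t n"
proof -
  have omega: "ennreal (exp (\<alpha> * u - c)) \<le> omega M r T L s \<alpha>" for \<alpha>
  proof (rule exp_le_if_minus_ln_ext_le)
    have "rate_arg M u r T L s \<alpha> \<le> rate M u r T L s" unfolding rate_def by (rule SUP_upper) simp
    then show "ereal (\<alpha> * u) - ln_ext (omega M r T L s \<alpha>) \<le> ereal c"
      using rate by (simp add: rate_arg_def)
  qed
  show ?thesis
  proof (cases s)
    case (real s')
    then have s': "0 \<le> s'" "ereal s' \<le> t" using assms(2) by auto
    show ?thesis
    proof (rule eventually_ruin_prob_ge[OF \<open>0 \<le> t\<close> _ _ _ \<open>a < - c\<close>, of "\<lambda>y. net_loss r (fst y) (snd y) s'"])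
      show "ennreal (exp (\<alpha> * u - c)) \<le>
          (\<integral>\<^sup>+x. ennreal (exp (\<alpha> * net_loss r (fst (T x, L x)) (snd (T x, L x)) s')) \<partial>M)" for \<alpha>
        using omega[of \<alpha>] real by (simp add: omega_def mgf_def)
    qed (use s' in auto)
  next
    case PInf
    then have "t = \<infinity>" using assms(2) by simp
    show ?thesis
    proof (rule eventually_ruin_prob_ge[OF \<open>0 \<le> t\<close> _ _ _ \<open>a < - c\<close>, of "\<lambda>y. snd y - r * fst y"])
      show "ennreal (exp (\<alpha> * u - c)) \<le>
          (\<integral>\<^sup>+x. ennreal (exp (\<alpha> * (snd (T x, L x) - r * fst (T x, L x)))) \<partial>M)" if "\<alpha> \<ge> 0" for \<alpha>
        using omega[of \<alpha>] PInf omega_infinity[OF that] by simp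
      fix n x assume n: "n > 0" and x: "x \<in> space M"
        and le: "real n * u \<le> (\<Sum>i=1..n. snd (Ti i x, Li i x) - r * fst (Ti i x, Li i x))"
      (* At time m all n obligors have defaulted, so the net losses have their terminal values. *)
      define m where "m = Max (insert 0 ((\<lambda>i. Ti i x) ` {1..n}))"
      have m: "Ti i x \<le> m" if "i \<in> {1..n}" for i
        unfolding m_def using that by (intro Max_ge) auto
      have "0 \<le> m" by (simp add: m_def)
      have "(\<Sum>i=1..n. snd (Ti i x, Li i x) - r * fst (Ti i x, Li i x)) =
          (\<Sum>i=1..n. net_loss r (Ti i x) (Li i x) m)"
        using m by (intro sum.cong) (auto simp: net_loss_altdef)
      then have "real n * u \<le> (\<Sum>i=1..n. net_loss r (Ti i x) (Li i x) m)" using le by simp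
      then show "x \<in> ruin_event t n" using x \<open>0 \<le> m\<close> \<open>t = \<infinity>\<close> by auto
    qed simp
  next
    case MInf
    then show ?thesis using assms(2) by simp
  qed
qed

theorem ruin_prob_rate:
  assumes "0 \<le> t" and min: "is_arg_min (rate M u r T L) (\<lambda>s. s \<in> {0..t}) ts"
  shows "(\<lambda>n. ereal (1 / real n) * ln_ext (ennreal (ruin_prob M u r Ti Li t n)))
           \<longlonglongrightarrow> - rate M u r T L ts"
proof (rule order_tendstoI)
  let ?R = "rate M u r T L"
  let ?q = "ruin_prob M u r Ti Li t"
  have le: "?R ts \<le> ?R s" if "s \<in> {0..t}" for s
    using min that by (auto simp: is_arg_min_def not_less)
  have ts: "ts \<in> {0..t}" using min by (simp add: is_arg_min_def)
  show "\<forall>\<^sub>F n in sequentially. a < ereal (1 / real n) * ln_ext (ennreal (?q n))"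
    if a: "a < - ?R ts" for a
  proof -
    obtain b where b: "a < ereal b" "ereal b < - ?R ts" using ereal_dense2[OF a] by blast
    obtain d where d: "ereal b < ereal d" "ereal d < - ?R ts" using ereal_dense2[OF b(2)] by blast
    have "?R ts \<le> ereal (- d)"
      using d(2) by (metis ereal_less_uminus_reorder less_imp_le uminus_ereal.simps(1))
    then have "\<forall>\<^sub>F n in sequentially. exp b ^ n \<le> ?q n"
      using d(1) by (intro eventually_ruin_prob_ge_rate[OF \<open>0 \<le> t\<close> ts]) auto
    then show ?thesis
      using eventually_gt_at_top[of 0]
    proof eventually_elim
      case (elim n)
      show ?case using b(1) ln_ext_root_ge[OF elim] by (rule order.strict_trans2)
    qed
  qed
  show "\<forall>\<^sub>F n in sequentially. ereal (1 / real n) * ln_ext (ennreal (?q n)) < a"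
    if a: "- ?R ts < a" for a
  proof -
    obtain b where b: "- ?R ts < ereal b" "ereal b < a" using ereal_dense2[OF a] by blast
    obtain d where d: "- ?R ts < ereal d" "ereal d < ereal b" using ereal_dense2[OF b(1)] by blast
    have "\<forall>\<^sub>F n in sequentially. ?q n \<le> exp (real n * b)"
    proof (cases "0 \<le> d")
      case True
      have "?q n \<le> exp (real n * b)" for n
      proof -
        have "?q n \<le> 1" by (simp add: ruin_prob_def)
        also have "1 \<le> exp (real n * b)" using True d(2) by simp
        finally show ?thesis .
      qed
      then show ?thesis by simp
    next
      case False
      have c: "ereal (- d) < ?R ts"
        using d(1) by (metis ereal_uminus_less_reorder uminus_ereal.simps(1))
      have "ereal (- d) < ?R (ereal s)" if "0 \<le> s" "ereal s \<le> t" for s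
        using c le[of "ereal s"] that by (intro order.strict_trans2[OF c]) auto
      then have le_q: "?q n \<le> real n * (exp (real n * d) * (1 + exp 1 * (real n * (- d) + 2)))" if "n > 0" for n
        using ruin_prob_le[OF \<open>0 \<le> t\<close>, of "- d" n] False that by simp
      have "\<forall>\<^sub>F n in sequentially.
          real n * (exp (real n * d) * (1 + exp 1 * (real n * (- d) + 2))) \<le> exp (real n * b)"
        using False d(2) by (intro eventually_prefactor_le_exp) auto
      then show ?thesis
        using eventually_gt_at_top[of 0]
      proof eventually_elim
        case (elim n)
        show ?case using le_q[OF elim(2)] elim(1) by (rule order_trans)
      qed
    qed
    then show ?thesis
      using eventually_gt_at_top[of 0]
    proof eventually_elim
      case (elim n)
      show ?case using ln_ext_root_le[OF elim] b(2) by (rule order.strict_trans1)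
    qed
  qed
qed

end

theorem theorem3p1:
  fixes M :: "'a measure" and u r :: real and t :: ereal
    and T L :: "'a \<Rightarrow> real" and f :: "real \<Rightarrow> ennreal"
    and Ti Li :: "nat \<Rightarrow> 'a \<Rightarrow> real"
    and alpha_star :: "ereal \<Rightarrow> real" and t_star :: ereal
  assumes "prob_space M"
    and "u > 0" and "r > 0" and "t \<ge> 0"
    and "distributed M lborel T f" and "AE x in M. T x \<ge> 0"
    and "L \<in> borel_measurable M" and "AE x in M. L x \<ge> 0"
    and "prob_space.indep_var M borel T borel L"
    and iid_indep: "prob_space.indep_vars M (\<lambda>_. borel \<Otimes>\<^sub>M borel) (\<lambda>i x. (Ti i x, Li i x)) {1..}"
    and iid_copies: "\<And>i. i \<ge> 1 \<Longrightarrow>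
           distr M (borel \<Otimes>\<^sub>M borel) (\<lambda>x. (Ti i x, Li i x))
             = distr M (borel \<Otimes>\<^sub>M borel) (\<lambda>x. (T x, L x))"
    and rarity: "(SUP s\<in>{0::real..}.
             ereal (measure M {x \<in> space M. T x \<le> s}) * enn2ereal (\<integral>\<^sup>+ x. ennreal (L x) \<partial>M)
               - ereal (r * (\<integral>x. min (T x) s \<partial>M))) < ereal u"
    and bounded: "bounded_argsup M u r (Ti 1) (Li 1) t alpha_star"
    and t_star: "is_arg_min (rate M u r (Ti 1) (Li 1)) (\<lambda>s. s \<in> {0..t}) t_star"
  shows "(\<lambda>n. ereal (1 / real n) * ln_ext (ennreal (ruin_prob M u r Ti Li t n)))
           \<longlonglongrightarrow> - rate M u r (Ti 1) (Li 1) t_star"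
proof -
  have "T \<in> borel_measurable M"
    using assms(5) by (simp add: distributed_def)
  then interpret iid_obligors M u r T L Ti Li
    using assms by (intro iid_obligors.intro iid_obligors_axioms.intro)
  have "rate M u r (Ti 1) (Li 1) = rate M u r T L"
    by (intro ext rate_obligor) simp
  then show ?thesis
    using ruin_prob_rate[OF \<open>t \<ge> 0\<close>] t_star by simp
qed

end
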